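(* Let $n\ge1$. The field $I_{F_n}$ of geometric invariants of space curves of embedding dimension $n+1$ is generated over $\mathbb{C}$ by the variables $x^{(0)},y_j^{(0)}$, the slopes and the first and higher algebraic curvatures $\kappa_{i,j}$, $i,j\in\mathbb{N}$, $1\le j\le n$, i.e., $$I_{F_n}=\mathbb{C}(x^{(0)},y_j^{(0)},\kappa_{i,j} : i,j\in\mathbb{N},\ 1\le j\le n).$$ Moreover, for each geometric invariant $p$ of space curves of embedding dimension $n+1$ the following equality is fulfilled: $$p=i_\kappa(p).$$
   Context: $\mathbb{N}=\{0,1,2,\dots\}$. Let $x^{(i)},y_j^{(i)},\varphi^{(i)}$ ($i\in\mathbb{N}$, $1\le j\le n$) be independent variables, $F_n=\mathbb{C}(x^{(i)},y_j^{(i)} : i\in\mathbb{N},1\le j\le n)$ and $L_n=F_n(\varphi^{(i)} : i\in\mathbb{N})$. Let $\partial$ be the $\mathbb{C}$-derivation of $F_n$ with $\partial x^{(i)}=x^{(i+1)}$, $\partial y_j^{(i)}=y_j^{(i+1)}$, and $\chi$ the $\mathbb{C}$-derivation of $L_n$ with $\chi(x^{(i)})=x^{(i+1)}\varphi^{(1)}$, $\chi(y_j^{(i)})=y_j^{(i+1)}\varphi^{(1)}$, $\chi(\varphi^{(i)})=\varphi^{(i+1)}$. Let $\Lambda:L_n\to L_n$ be the field homomorphism over $\mathbb{C}$ with $\Lambda(x^{(i)})=\chi^i(x^{(0)})$, $\Lambda(y_j^{(i)})=\chi^i(y_j^{(0)})$, $\Lambda(\varphi^{(i)})=\chi^i(\varphi^{(0)})$,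 where $\chi^i$ is the $i$-fold composition. An element $p\in F_n$ is a geometric invariant of space curves of embedding dimension $n+1$ if $\Lambda(p)=p$; $I_{F_n}$ is the field of all of them. The slopes ($i=0$), first ($i=1$) and higher ($i\ge2$) algebraic curvatures are $$\kappa_{0,j}=\frac{y_j^{(1)}}{x^{(1)}},\qquad \kappa_{1,j}=\frac{y_j^{(2)}x^{(1)}-y_j^{(1)}x^{(2)}}{(x^{(1)})^3},\qquad \kappa_{i+1,j}=\frac{\partial(\kappa_{i,j})}{x^{(1)}}\ (i\ge1).$$ The $\mathbb{C}$-morphism $i_\kappa:F_n\to F_n$ is given by the substitution $x^{(0)}\mapsto x^{(0)}$, $x^{(1)}\mapsto1$, $x^{(i)}\mapsto0$ for all $i\ge2$, $y_j^{(0)}\mapsto y_j^{(0)}$, $y_j^{(i)}\mapsto\kappa_{i-1,j}$ for all $i\ge1$, $1\le j\le n$. *)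

theory Defs
  imports Complex_Main "HOL-Library.Poly_Mapping"
    "HOL-Computational_Algebra.Fraction_Field"
    "HOL-Computational_Algebra.Formal_Power_Series"
begin

hide_const (open) Rat.Fract

section \<open>The rational function field\<close>

text \<open>The indeterminates are \<open>X i\<close> for $x^{(i)}$, \<open>Y j i\<close> for $y_j^{(i)}$ and \<open>Phi i\<close> for
  $\varphi^{(i)}$. The type contains \<open>Y j i\<close> for every \<open>j\<close>; the restriction to $1 \le j \le n$ is made
  by the subfields \<open>F_field n\<close> and \<open>L_field n\<close> below.\<close>

datatype var = X nat | Y nat nat | Phi nat

text \<open>The order on the indeterminates plays no mathematical role: the library needs some linear
  order to show that the polynomials have no zero divisors.\<close>

fun var_code :: "var \<Rightarrow> nat \<times> nat \<times> nat" where
  "var_code (X i) = (0, 0, i)"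
| "var_code (Y j i) = (1, j, i)"
| "var_code (Phi i) = (2, 0, i)"

lemma var_code_inject: "var_code u = var_code v \<longleftrightarrow> u = v"
  by (cases u; cases v) auto

instantiation var :: linorder
begin

definition less_eq_var :: "var \<Rightarrow> var \<Rightarrow> bool" where
  "u \<le> v \<longleftrightarrow> (case (var_code u, var_code v) of ((a, b, c), (a', b', c')) \<Rightarrow>
     a < a' \<or> a = a' \<and> (b < b' \<or> b = b' \<and> c \<le> c'))"

definition less_var :: "var \<Rightarrow> var \<Rightarrow> bool" where
  "u < v \<longleftrightarrow> u \<le> v \<and> \<not> v \<le> (u :: var)"

instance
proof
  fix u v w :: var
  show "u < v \<longleftrightarrow> u \<le> v \<and> \<not> v \<le> u" by (simp add: less_var_def)
  show "u \<le> u" by (auto simp: less_eq_var_def split: prod.splits)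
  show "u \<le> v \<Longrightarrow> v \<le> w \<Longrightarrow> u \<le> w" by (auto simp: less_eq_var_def split: prod.splits)
  show "u \<le> v \<or> v \<le> u" by (auto simp: less_eq_var_def split: prod.splits)
  assume "u \<le> v" "v \<le> u"
  then have "var_code u = var_code v" by (auto simp: less_eq_var_def split: prod.splits)
  then show "u = v" by (simp add: var_code_inject)
qed

end

type_synonym cpoly = "(var \<Rightarrow>\<^sub>0 nat) \<Rightarrow>\<^sub>0 complex"
type_synonym ratfun = "cpoly fract"

definition cst :: "complex \<Rightarrow> ratfun" where
  "cst c = Fract (Poly_Mapping.single 0 c) 1"

definition indet :: "var \<Rightarrow> ratfun" where
  "indet v = Fract (Poly_Mapping.single (Poly_Mapping.single v 1) 1) 1"

abbreviation xv :: "nat \<Rightarrow> ratfun" where "xv i \<equiv> indet (X i)"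
abbreviation yv :: "nat \<Rightarrow> nat \<Rightarrow> ratfun" where "yv j i \<equiv> indet (Y j i)"
abbreviation phiv :: "nat \<Rightarrow> ratfun" where "phiv i \<equiv> indet (Phi i)"

definition is_subfield :: "ratfun set \<Rightarrow> bool" where
  "is_subfield K \<longleftrightarrow> 1 \<in> K \<and> (\<forall>a\<in>K. \<forall>b\<in>K. a - b \<in> K \<and> a * b \<in> K) \<and> (\<forall>a\<in>K. inverse a \<in> K)"

text \<open>$\mathbb{C}(S)$\<close>

definition C_adjoin :: "ratfun set \<Rightarrow> ratfun set" where
  "C_adjoin S = \<Inter>{K. is_subfield K \<and> range cst \<subseteq> K \<and> S \<subseteq> K}"

definition F_vars :: "nat \<Rightarrow> var set" where
  "F_vars n = {X i | i. True} \<union> {Y j i | j i. 1 \<le> j \<and> j \<le> n}"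

definition L_vars :: "nat \<Rightarrow> var set" where
  "L_vars n = F_vars n \<union> {Phi i | i. True}"

definition F_field :: "nat \<Rightarrow> ratfun set" where
  "F_field n = C_adjoin (indet ` F_vars n)"

definition L_field :: "nat \<Rightarrow> ratfun set" where
  "L_field n = C_adjoin (indet ` L_vars n)"


section \<open>Derivations, homomorphisms and substitutions\<close>

definition C_derivation_on :: "ratfun set \<Rightarrow> (ratfun \<Rightarrow> ratfun) \<Rightarrow> bool" where
  "C_derivation_on K D \<longleftrightarrow>
     (\<forall>p\<in>K. \<forall>q\<in>K. D (p + q) = D p + D q \<and> D (p * q) = D p * q + p * D q) \<and>
     (\<forall>c. D (cst c) = 0)"

definition C_hom_on :: "ratfun set \<Rightarrow> (ratfun \<Rightarrow> ratfun) \<Rightarrow> bool" where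
  "C_hom_on K f \<longleftrightarrow>
     (\<forall>p\<in>K. \<forall>q\<in>K. f (p + q) = f p + f q \<and> f (p * q) = f p * f q) \<and>
     (\<forall>c. f (cst c) = cst c)"

definition derivation_with :: "(var \<Rightarrow> ratfun) \<Rightarrow> ratfun \<Rightarrow> ratfun" where
  "derivation_with \<delta> = (THE D. C_derivation_on UNIV D \<and> (\<forall>v. D (indet v) = \<delta> v))"

definition hom_with :: "(var \<Rightarrow> ratfun) \<Rightarrow> ratfun \<Rightarrow> ratfun" where
  "hom_with \<sigma> = (THE f. C_hom_on UNIV f \<and> (\<forall>v. f (indet v) = \<sigma> v))"

definition monom_eval :: "(var \<Rightarrow> 'a::comm_ring_1) \<Rightarrow> (var \<Rightarrow>\<^sub>0 nat) \<Rightarrow> 'a" where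
  "monom_eval \<sigma> m = (\<Prod>v\<in>Poly_Mapping.keys m. \<sigma> v ^ Poly_Mapping.lookup m v)"

definition poly_eval :: "(complex \<Rightarrow> 'a) \<Rightarrow> (var \<Rightarrow> 'a::comm_ring_1) \<Rightarrow> cpoly \<Rightarrow> 'a" where
  "poly_eval h \<sigma> a = (\<Sum>m\<in>Poly_Mapping.keys a. h (Poly_Mapping.lookup a m) * monom_eval \<sigma> m)"

text \<open>A substitution of rational functions for the indeterminates need not be injective on
  polynomials, so it only acts on those fractions that can be written with a denominator that does
  not vanish under the substitution.\<close>

definition subst_dom :: "(var \<Rightarrow> ratfun) \<Rightarrow> ratfun set" where
  "subst_dom \<sigma> = {Fract a b | a b. b \<noteq> 0 \<and> poly_eval cst \<sigma> b \<noteq> 0}"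

definition subst :: "(var \<Rightarrow> ratfun) \<Rightarrow> ratfun \<Rightarrow> ratfun" where
  "subst \<sigma> p = (THE q. \<exists>a b. p = Fract a b \<and> b \<noteq> 0 \<and> poly_eval cst \<sigma> b \<noteq> 0 \<and>
     q = poly_eval cst \<sigma> a / poly_eval cst \<sigma> b)"


section \<open>Geometric invariants and algebraic curvatures\<close>

text \<open>$\partial$ is only needed on $F_n$; on the larger type it is extended by
  $\partial\varphi^{(i)} = 0$.\<close>

definition partial :: "ratfun \<Rightarrow> ratfun" where
  "partial = derivation_with (\<lambda>v. case v of
     X i \<Rightarrow> xv (Suc i) | Y j i \<Rightarrow> yv j (Suc i) | Phi i \<Rightarrow> 0)"

definition chi :: "ratfun \<Rightarrow> ratfun" where
  "chi = derivation_with (\<lambda>v. case v of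
     X i \<Rightarrow> xv (Suc i) * phiv 1 | Y j i \<Rightarrow> yv j (Suc i) * phiv 1 | Phi i \<Rightarrow> phiv (Suc i))"

definition Lambda_val :: "var \<Rightarrow> ratfun" where
  "Lambda_val v = (case v of
     X i \<Rightarrow> (chi ^^ i) (xv 0) | Y j i \<Rightarrow> (chi ^^ i) (yv j 0) | Phi i \<Rightarrow> (chi ^^ i) (phiv 0))"

definition Lambda :: "ratfun \<Rightarrow> ratfun" where
  "Lambda = hom_with Lambda_val"

definition geometric_invariants :: "nat \<Rightarrow> ratfun set" where
  "geometric_invariants n = {p \<in> F_field n. Lambda p = p}"

fun kappa :: "nat \<Rightarrow> nat \<Rightarrow> ratfun" where
  "kappa 0 j = yv j 1 / xv 1"
| "kappa (Suc 0) j = (yv j 2 * xv 1 - yv j 1 * xv 2) / xv 1 ^ 3"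
| "kappa (Suc (Suc i)) j = partial (kappa (Suc i) j) / xv 1"

text \<open>The values on \<open>Phi i\<close> are irrelevant, since $i_\kappa$ is only applied to elements of
  $F_n$.\<close>

fun i_kappa_val :: "var \<Rightarrow> ratfun" where
  "i_kappa_val (X i) = (if i = 0 then xv 0 else if i = 1 then 1 else 0)"
| "i_kappa_val (Y j i) = (if i = 0 then yv j 0 else kappa (i - 1) j)"
| "i_kappa_val (Phi i) = phiv i"

definition i_kappa_dom :: "ratfun set" where
  "i_kappa_dom = subst_dom i_kappa_val"

definition i_kappa :: "ratfun \<Rightarrow> ratfun" where
  "i_kappa = subst i_kappa_val"


section \<open>Evaluation of polynomials\<close>

abbreviation emb :: "cpoly \<Rightarrow> ratfun" where "emb a \<equiv> Fract a 1"

lemma monom_eval_superset: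
  "finite A \<Longrightarrow> Poly_Mapping.keys m \<subseteq> A \<Longrightarrow> monom_eval \<sigma> m = (\<Prod>v\<in>A. \<sigma> v ^ Poly_Mapping.lookup m v)"
  unfolding monom_eval_def by (rule prod.mono_neutral_left) (auto simp: in_keys_iff)

lemma monom_eval_add: "monom_eval \<sigma> (m + m') = monom_eval \<sigma> m * monom_eval \<sigma> m'"
proof -
  let ?A = "Poly_Mapping.keys m \<union> Poly_Mapping.keys m'"
  have k: "Poly_Mapping.keys (m + m') \<subseteq> ?A" by (rule keys_add)
  show ?thesis
    by (subst (1 2 3) monom_eval_superset[of ?A])
      (use k in \<open>auto simp: lookup_add power_add prod.distrib\<close>)
qed

lemma monom_eval_0 [simp]: "monom_eval \<sigma> 0 = 1"
  by (simp add: monom_eval_def)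

lemma monom_eval_var [simp]: "monom_eval \<sigma> (Poly_Mapping.single v (Suc 0)) = \<sigma> v"
  by (simp add: monom_eval_def)

locale coeff_hom =
  fixes h :: "complex \<Rightarrow> 'a::comm_ring_1"
  assumes h_add: "h (a + b) = h a + h b" and h_mult: "h (a * b) = h a * h b" and h_1: "h 1 = 1"
begin

lemma h_0 [simp]: "h 0 = 0"
  using h_add[of 0 0] by simp

lemma poly_eval_superset:
  "finite A \<Longrightarrow> Poly_Mapping.keys a \<subseteq> A \<Longrightarrow> poly_eval h \<sigma> a = (\<Sum>m\<in>A. h (Poly_Mapping.lookup a m) * monom_eval \<sigma> m)"
  unfolding poly_eval_def by (rule sum.mono_neutral_left) (auto simp: in_keys_iff)

lemma poly_eval_add: "poly_eval h \<sigma> (a + b) = poly_eval h \<sigma> a + poly_eval h \<sigma> b"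
proof -
  let ?A = "Poly_Mapping.keys a \<union> Poly_Mapping.keys b"
  have k: "Poly_Mapping.keys (a + b) \<subseteq> ?A" by (rule keys_add)
  show ?thesis
    by (subst (1 2 3) poly_eval_superset[of ?A])
      (use k in \<open>auto simp: lookup_add h_add algebra_simps sum.distrib\<close>)
qed

lemma poly_eval_0 [simp]: "poly_eval h \<sigma> 0 = 0"
  by (simp add: poly_eval_def)

lemma poly_eval_single: "poly_eval h \<sigma> (Poly_Mapping.single m c) = h c * monom_eval \<sigma> m"
  by (subst poly_eval_superset[of "{m}"]) auto

lemma poly_eval_sum: "poly_eval h \<sigma> (sum f A) = (\<Sum>i\<in>A. poly_eval h \<sigma> (f i))"
  by (induction A rule: infinite_finite_induct) (auto simp: poly_eval_add)

end

lemma poly_decomp: "(a :: cpoly) = (\<Sum>m\<in>Poly_Mapping.keys a. Poly_Mapping.single m (Poly_Mapping.lookup a m))"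
proof (rule poly_mapping_eqI)
  fix k
  show "Poly_Mapping.lookup a k = Poly_Mapping.lookup (\<Sum>m\<in>Poly_Mapping.keys a. Poly_Mapping.single m (Poly_Mapping.lookup a m)) k"
    by (cases "k \<in> Poly_Mapping.keys a") (auto simp: lookup_sum lookup_single when_def in_keys_iff)
qed

context coeff_hom
begin

lemma poly_eval_mult: "poly_eval h \<sigma> (a * b) = poly_eval h \<sigma> a * poly_eval h \<sigma> b"
proof -
  let ?s = "\<lambda>a m. Poly_Mapping.single m (Poly_Mapping.lookup a m) :: cpoly"
  have "poly_eval h \<sigma> (a * b) = poly_eval h \<sigma> ((\<Sum>m\<in>Poly_Mapping.keys a. ?s a m) * (\<Sum>k\<in>Poly_Mapping.keys b. ?s b k))"
    by (simp only: poly_decomp[symmetric])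
  also have "\<dots> = (\<Sum>m\<in>Poly_Mapping.keys a. \<Sum>k\<in>Poly_Mapping.keys b. poly_eval h \<sigma> (?s a m * ?s b k))"
    by (simp add: sum_product poly_eval_sum)
  also have "\<dots> = (\<Sum>m\<in>Poly_Mapping.keys a. \<Sum>k\<in>Poly_Mapping.keys b. poly_eval h \<sigma> (?s a m) * poly_eval h \<sigma> (?s b k))"
    by (simp add: mult_single poly_eval_single h_mult monom_eval_add algebra_simps)
  also have "\<dots> = poly_eval h \<sigma> (\<Sum>m\<in>Poly_Mapping.keys a. ?s a m) * poly_eval h \<sigma> (\<Sum>k\<in>Poly_Mapping.keys b. ?s b k)"
    by (simp add: sum_product poly_eval_sum)
  finally show ?thesis by (simp only: poly_decomp[symmetric])
qed

lemma poly_eval_const: "poly_eval h \<sigma> (Poly_Mapping.single 0 c) = h c"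
  by (simp add: poly_eval_single)

lemma poly_eval_1 [simp]: "poly_eval h \<sigma> 1 = 1"
  by (simp flip: single_one add: poly_eval_const h_1)

lemma poly_eval_var: "poly_eval h \<sigma> (Poly_Mapping.single (Poly_Mapping.single v (Suc 0)) 1) = \<sigma> v"
  by (simp add: poly_eval_single h_1)

end

lemma poly_induct [case_names const var add mult]:
  fixes a :: cpoly
  assumes const: "\<And>c. P (Poly_Mapping.single 0 c)"
    and var: "\<And>v. P (Poly_Mapping.single (Poly_Mapping.single v (Suc 0)) 1)"
    and add: "\<And>a b. P a \<Longrightarrow> P b \<Longrightarrow> P (a + b)"
    and mult: "\<And>a b. P a \<Longrightarrow> P b \<Longrightarrow> P (a * b)"
  shows "P a"
proof -
  have vp: "P (Poly_Mapping.single (Poly_Mapping.single v k) 1)" for v k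
  proof (induction k)
    case 0
    then show ?case using const[of 1] by simp
  next
    case (Suc k)
    have "Poly_Mapping.single (Poly_Mapping.single v (Suc k)) (1::complex) =
      Poly_Mapping.single (Poly_Mapping.single v (Suc 0)) 1 * Poly_Mapping.single (Poly_Mapping.single v k) 1"
      by (simp add: mult_single flip: single_add)
    then show ?case using mult[OF var Suc] by metis
  qed
  have mon: "P (Poly_Mapping.single m 1)" for m
  proof (induction m rule: update_induct)
    case const
    then show ?case using assms(1)[of 1] by simp
  next
    case (update m v k)
    have "Poly_Mapping.update v k m = Poly_Mapping.single v k + m"
      using update by (intro poly_mapping_eqI)
        (auto simp: lookup_update lookup_add lookup_single when_def in_keys_iff)
    then have "Poly_Mapping.single (Poly_Mapping.update v k m) (1::complex) =
      Poly_Mapping.single (Poly_Mapping.single v k) 1 * Poly_Mapping.single m 1"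
      by (simp add: mult_single)
    then show ?case using mult[OF vp update(3)] by metis
  qed
  have trm: "P (Poly_Mapping.single m c)" for m c
    using mult[OF const[of c] mon[of m]] by (simp add: mult_single)
  have "P (\<Sum>m\<in>A. Poly_Mapping.single m (Poly_Mapping.lookup a m))" if "finite A" for A
    using that
  proof induction
    case empty
    then show ?case using const[of 0] by simp
  next
    case (insert m A)
    then show ?case using add[OF trm] by simp
  qed
  then show ?thesis using poly_decomp[of a] by (metis finite_keys)
qed

interpretation cst: coeff_hom cst
  by unfold_locales (simp_all add: cst_def single_add mult_single One_fract_def)

lemma cst_0 [simp]: "cst 0 = 0" by simp
lemma cst_1 [simp]: "cst 1 = 1" by (rule cst.h_1)

lemma emb_add: "emb (a + b) = emb a + emb b" by simp
lemma emb_mult: "emb (a * b) = emb a * emb b" by simp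
lemma emb_eq_0_iff: "emb a = 0 \<longleftrightarrow> a = 0" by (simp add: Zero_fract_def eq_fract)

lemma Fract_eq_emb: "b \<noteq> 0 \<Longrightarrow> Fract a b = emb a / emb b"
  by simp

lemma emb_eq_poly_eval: "emb a = poly_eval cst indet a"
proof (induction a rule: poly_induct)
  case (const c)
  then show ?case by (simp add: cst.poly_eval_const cst_def[of c])
next
  case (var v)
  then show ?case by (simp only: cst.poly_eval_var) (simp add: indet_def)
next
  case (add a b)
  then show ?case by (metis cst.poly_eval_add emb_add)
next
  case (mult a b)
  then show ?case by (metis cst.poly_eval_mult emb_mult)
qed

lemma indet_neq_0: "indet v \<noteq> 0"
  unfolding indet_def emb_eq_0_iff by (metis lookup_single_eq lookup_zero zero_neq_one)


section \<open>Adjunction\<close>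

lemma is_subfield_closed:
  assumes "is_subfield K"
  shows "0 \<in> K" "1 \<in> K" "a \<in> K \<Longrightarrow> b \<in> K \<Longrightarrow> a + b \<in> K" "a \<in> K \<Longrightarrow> - a \<in> K"
    "a \<in> K \<Longrightarrow> b \<in> K \<Longrightarrow> a - b \<in> K" "a \<in> K \<Longrightarrow> b \<in> K \<Longrightarrow> a * b \<in> K" "a \<in> K \<Longrightarrow> inverse a \<in> K"
    "a \<in> K \<Longrightarrow> b \<in> K \<Longrightarrow> a / b \<in> K"
proof -
  show z: "0 \<in> K" using assms unfolding is_subfield_def by (metis diff_self)
  show n: "- a \<in> K" if "a \<in> K" for a
    using assms z that unfolding is_subfield_def by (metis diff_0)
  show "a + b \<in> K" if "a \<in> K" "b \<in> K" for a b
    using assms n that unfolding is_subfield_def by (metis diff_minus_eq_add)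
qed (use assms in \<open>auto simp: is_subfield_def divide_inverse\<close>)

lemma C_adjoin_subfield: "is_subfield (C_adjoin S)"
  unfolding C_adjoin_def is_subfield_def by blast

lemma C_adjoin_superset: "S \<subseteq> C_adjoin S" "cst c \<in> C_adjoin S"
  unfolding C_adjoin_def by blast+

lemma C_adjoin_minimal: "is_subfield K \<Longrightarrow> range cst \<subseteq> K \<Longrightarrow> S \<subseteq> K \<Longrightarrow> C_adjoin S \<subseteq> K"
  unfolding C_adjoin_def by blast

lemma C_adjoin_all_indets: "C_adjoin (range indet) = UNIV"
proof -
  note cl = is_subfield_closed[OF C_adjoin_subfield]
  have e: "emb a \<in> C_adjoin (range indet)" for a
  proof (induction a rule: poly_induct)
    case (const c)
    then show ?case using C_adjoin_superset(2) by (simp add: cst_def)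
  next
    case (var v)
    then show ?case using C_adjoin_superset(1)[of "range indet"] by (auto simp: indet_def)
  next
    case (add a b)
    then show ?case by (metis cl(3) emb_add)
  next
    case (mult a b)
    then show ?case by (metis cl(6) emb_mult)
  qed
  have "p \<in> C_adjoin (range indet)" for p
  proof (cases p)
    case (Fract a b)
    then show ?thesis using cl(8)[OF e e] Fract_eq_emb by metis
  qed
  then show ?thesis by blast
qed

lemma C_derivation_on_rules:
  assumes D: "C_derivation_on K D" and K: "is_subfield K" and a: "a \<in> K" and b: "b \<in> K"
  shows "D 0 = 0" "D 1 = 0" "D (- a) = - D a" "D (a - b) = D a - D b"
    "D (inverse a) = - D a * inverse a ^ 2"
proof -
  note cl = is_subfield_closed[OF K]
  note add = D[unfolded C_derivation_on_def, THEN conjunct1, rule_format, THEN conjunct1]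
  note mult = D[unfolded C_derivation_on_def, THEN conjunct1, rule_format, THEN conjunct2]
  show z: "D 0 = 0" using D cst_0 unfolding C_derivation_on_def by metis
  show o: "D 1 = 0" using D cst_1 unfolding C_derivation_on_def by metis
  have m: "D (- a) = - D a" if "a \<in> K" for a
    using add[OF that cl(4)[OF that]] z by (simp add: eq_neg_iff_add_eq_0 add.commute)
  then show "D (- a) = - D a" using a .
  show "D (a - b) = D a - D b" using add[OF a cl(4)[OF b]] m[OF b] by simp
  show "D (inverse a) = - D a * inverse a ^ 2"
  proof (cases "a = 0")
    case False
    have "D (a * inverse a) = 0" using False o by simp
    then have *: "D a * inverse a + a * D (inverse a) = 0" using mult[OF a cl(7)[OF a]] by simp
    have "D (inverse a) = inverse a * (a * D (inverse a))" using False by simp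
    also have "a * D (inverse a) = - (D a * inverse a)" using * by (simp add: eq_neg_iff_add_eq_0 add.commute)
    finally show ?thesis by (simp add: power2_eq_square)
  qed (use z in simp)
qed

lemma C_derivation_on_subset: "C_derivation_on K D \<Longrightarrow> K' \<subseteq> K \<Longrightarrow> C_derivation_on K' D"
  unfolding C_derivation_on_def by blast

lemma C_derivation_unique:
  assumes "C_derivation_on (C_adjoin S) D" "C_derivation_on (C_adjoin S) D'"
    and "\<And>s. s \<in> S \<Longrightarrow> D s = D' s" and "p \<in> C_adjoin S"
  shows "D p = D' p"
proof -
  let ?K = "{p \<in> C_adjoin S. D p = D' p}"
  note sf = C_adjoin_subfield[of S]
  note cl = is_subfield_closed[OF sf]
  note r = C_derivation_on_rules[OF assms(1) sf] C_derivation_on_rules[OF assms(2) sf]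
  have "is_subfield ?K"
    unfolding is_subfield_def using assms(1,2)
    by (auto simp: cl r(4,5,9,10) r(2,7)[OF cl(1) cl(1)] C_derivation_on_def)
  moreover have "range cst \<subseteq> ?K"
    using assms(1,2) C_adjoin_superset(2) by (auto simp: C_derivation_on_def)
  moreover have "S \<subseteq> ?K" using assms(3) C_adjoin_superset(1) by blast
  ultimately show ?thesis using C_adjoin_minimal assms(4) by blast
qed

lemma C_derivation_closed:
  assumes "C_derivation_on (C_adjoin S) D" "\<And>s. s \<in> S \<Longrightarrow> D s \<in> C_adjoin S" "p \<in> C_adjoin S"
  shows "D p \<in> C_adjoin S"
proof -
  let ?K = "{p \<in> C_adjoin S. D p \<in> C_adjoin S}"
  note sf = C_adjoin_subfield[of S]
  note cl = is_subfield_closed[OF sf]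
  note r = C_derivation_on_rules[OF assms(1) sf]
  have "is_subfield ?K"
    unfolding is_subfield_def using assms(1)
    by (auto simp: cl r(4,5) r(2)[OF cl(1) cl(1)] C_derivation_on_def power2_eq_square)
  moreover have "range cst \<subseteq> ?K"
    using assms(1) C_adjoin_superset(2) cl(1) by (auto simp: C_derivation_on_def)
  moreover have "S \<subseteq> ?K" using assms(2) C_adjoin_superset(1) by blast
  ultimately show ?thesis using C_adjoin_minimal assms(3) by blast
qed

lemma C_hom_on_rules:
  assumes f: "C_hom_on K f" and K: "is_subfield K" and a: "a \<in> K" and b: "b \<in> K"
  shows "f 0 = 0" "f 1 = 1" "f (- a) = - f a" "f (a - b) = f a - f b"
    "f (inverse a) = inverse (f a)"
proof -
  note cl = is_subfield_closed[OF K]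
  note add = f[unfolded C_hom_on_def, THEN conjunct1, rule_format, THEN conjunct1]
  note mult = f[unfolded C_hom_on_def, THEN conjunct1, rule_format, THEN conjunct2]
  show z: "f 0 = 0" using f cst_0 unfolding C_hom_on_def by metis
  show o: "f 1 = 1" using f cst_1 unfolding C_hom_on_def by metis
  have m: "f (- a) = - f a" if "a \<in> K" for a
    using add[OF that cl(4)[OF that]] z by (simp add: eq_neg_iff_add_eq_0 add.commute)
  then show "f (- a) = - f a" using a .
  show "f (a - b) = f a - f b" using add[OF a cl(4)[OF b]] m[OF b] by simp
  show "f (inverse a) = inverse (f a)"
  proof (cases "a = 0")
    case False
    have "f (a * inverse a) = 1" using False o by simp
    then have *: "f a * f (inverse a) = 1" using mult[OF a cl(7)[OF a]] by simp
    then show ?thesis by (metis inverse_unique)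
  qed (use z in simp)
qed

lemma C_hom_unique:
  assumes "C_hom_on (C_adjoin S) f" "C_hom_on (C_adjoin S) g"
    and "\<And>s. s \<in> S \<Longrightarrow> f s = g s" and "p \<in> C_adjoin S"
  shows "f p = g p"
proof -
  let ?K = "{p \<in> C_adjoin S. f p = g p}"
  note sf = C_adjoin_subfield[of S]
  note cl = is_subfield_closed[OF sf]
  note r = C_hom_on_rules[OF assms(1) sf] C_hom_on_rules[OF assms(2) sf]
  have "is_subfield ?K"
    unfolding is_subfield_def using assms(1,2)
    by (auto simp: cl r(4,5,9,10) r(2,7)[OF cl(1) cl(1)] C_hom_on_def)
  moreover have "range cst \<subseteq> ?K"
    using assms(1,2) C_adjoin_superset(2) by (auto simp: C_hom_on_def)
  moreover have "S \<subseteq> ?K" using assms(3) C_adjoin_superset(1) by blast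
  ultimately show ?thesis using C_adjoin_minimal assms(4) by blast
qed

lemma C_hom_closed:
  assumes "C_hom_on (C_adjoin S) f" "\<And>s. s \<in> S \<Longrightarrow> f s \<in> C_adjoin S" "p \<in> C_adjoin S"
  shows "f p \<in> C_adjoin S"
proof -
  let ?K = "{p \<in> C_adjoin S. f p \<in> C_adjoin S}"
  note sf = C_adjoin_subfield[of S]
  note cl = is_subfield_closed[OF sf]
  note r = C_hom_on_rules[OF assms(1) sf]
  have "is_subfield ?K"
    unfolding is_subfield_def using assms(1)
    by (auto simp: cl r(4,5) r(2)[OF cl(1) cl(1)] C_hom_on_def)
  moreover have "range cst \<subseteq> ?K"
    using assms(1) C_adjoin_superset(2) by (auto simp: C_hom_on_def)
  moreover have "S \<subseteq> ?K" using assms(2) C_adjoin_superset(1) by blast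
  ultimately show ?thesis using C_adjoin_minimal assms(3) by blast
qed


section \<open>Existence of derivations with prescribed values\<close>

text \<open>The derivative of a polynomial is the linear coefficient after the substitution
  $v \mapsto v + \delta(v)\,t$.\<close>

definition poly_deriv :: "(var \<Rightarrow> ratfun) \<Rightarrow> cpoly \<Rightarrow> ratfun" where
  "poly_deriv \<delta> a =
     fps_nth (poly_eval (\<lambda>c. fps_const (cst c))
       (\<lambda>v. fps_const (indet v) + fps_const (\<delta> v) * fps_X) a) 1"

interpretation fcst: coeff_hom "\<lambda>c. fps_const (cst c)"
  by unfold_locales (simp_all add: cst.h_add cst.h_mult)

lemma poly_deriv_aux:
  "fps_nth (poly_eval (\<lambda>c. fps_const (cst c))
     (\<lambda>v. fps_const (indet v) + fps_const (\<delta> v) * fps_X) a) 0 = emb a"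
proof (induction a rule: poly_induct)
  case (const c)
  then show ?case by (simp only: fcst.poly_eval_const) (simp add: cst_def)
next
  case (var v)
  then show ?case by (simp only: fcst.poly_eval_var) (simp add: indet_def)
next
  case (add a b)
  then show ?case by (simp only: fcst.poly_eval_add fps_add_nth emb_add)
next
  case (mult a b)
  then show ?case by (simp only: fcst.poly_eval_mult fps_mult_nth_0 emb_mult)
qed

lemma poly_deriv_const: "poly_deriv \<delta> (Poly_Mapping.single 0 c) = 0"
  by (simp add: poly_deriv_def fcst.poly_eval_const)

lemma poly_deriv_var: "poly_deriv \<delta> (Poly_Mapping.single (Poly_Mapping.single v (Suc 0)) 1) = \<delta> v"
  by (simp only: poly_deriv_def fcst.poly_eval_var) simp

lemma poly_deriv_add: "poly_deriv \<delta> (a + b) = poly_deriv \<delta> a + poly_deriv \<delta> b"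
  by (simp add: poly_deriv_def fcst.poly_eval_add)

lemma poly_deriv_mult: "poly_deriv \<delta> (a * b) = poly_deriv \<delta> a * emb b + emb a * poly_deriv \<delta> b"
  by (simp add: poly_deriv_def fcst.poly_eval_mult fps_mult_nth_1 poly_deriv_aux)

definition fract_deriv :: "(var \<Rightarrow> ratfun) \<Rightarrow> ratfun \<Rightarrow> ratfun" where
  "fract_deriv \<delta> p = (THE q. \<exists>a b. p = Fract a b \<and> b \<noteq> 0 \<and>
     q = (poly_deriv \<delta> a * emb b - emb a * poly_deriv \<delta> b) / emb b ^ 2)"

lemma fract_deriv:
  assumes b: "b \<noteq> 0"
  shows "fract_deriv \<delta> (Fract a b) = (poly_deriv \<delta> a * emb b - emb a * poly_deriv \<delta> b) / emb b ^ 2"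
  unfolding fract_deriv_def
proof (rule the_equality)
  fix q
  assume "\<exists>a' b'. Fract a b = Fract a' b' \<and> b' \<noteq> 0 \<and>
    q = (poly_deriv \<delta> a' * emb b' - emb a' * poly_deriv \<delta> b') / emb b' ^ 2"
  then obtain c d where cd: "Fract a b = Fract c d" "d \<noteq> 0"
    "q = (poly_deriv \<delta> c * emb d - emb c * poly_deriv \<delta> d) / emb d ^ 2" by blast
  have e: "a * d = c * b" using cd b by (simp add: eq_fract)
  define A B C D A' B' C' D' where "A = emb a" "B = emb b" "C = emb c" "D = emb d"
    and "A' = poly_deriv \<delta> a" "B' = poly_deriv \<delta> b" "C' = poly_deriv \<delta> c" "D' = poly_deriv \<delta> d"
  note defs = this
  have nz: "B \<noteq> 0" "D \<noteq> 0" using b cd(2) by (auto simp: defs emb_eq_0_iff)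
  have 1: "A * D = C * B" using e by (metis defs(1-4) emb_mult)
  have 2: "A' * D + A * D' = C' * B + C * B'"
    using e poly_deriv_mult unfolding defs by metis
  have "(C' * D - C * D') * B ^ 2 = (A' * B - A * B') * D ^ 2"
    using 1 2 by algebra
  then have "(C' * D - C * D') / D ^ 2 = (A' * B - A * B') / B ^ 2"
    using nz by (simp add: frac_eq_eq)
  then show "q = (poly_deriv \<delta> a * emb b - emb a * poly_deriv \<delta> b) / emb b ^ 2"
    using cd(3) unfolding defs by simp
qed (use b in blast)

lemma fract_deriv_emb: "fract_deriv \<delta> (emb a) = poly_deriv \<delta> a"
proof -
  have "poly_deriv \<delta> 1 = 0" using poly_deriv_const[of \<delta> 1] by simp
  then show ?thesis using fract_deriv[of 1 \<delta> a] by (simp flip: One_fract_def)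
qed

lemma fract_deriv_derivation: "C_derivation_on UNIV (fract_deriv \<delta>)"
  unfolding C_derivation_on_def
proof (intro conjI ballI allI)
  fix p q :: ratfun
  obtain a b where p: "p = Fract a b" "b \<noteq> 0" by (cases p)
  obtain c d where q: "q = Fract c d" "d \<noteq> 0" by (cases q)
  have bd: "b * d \<noteq> 0" using p q by simp
  define A B C D A' B' C' D' where "A = emb a" "B = emb b" "C = emb c" "D = emb d"
    and "A' = poly_deriv \<delta> a" "B' = poly_deriv \<delta> b" "C' = poly_deriv \<delta> c" "D' = poly_deriv \<delta> d"
  note defs = this
  have nz: "B \<noteq> 0" "D \<noteq> 0" using p q by (auto simp: defs emb_eq_0_iff)
  have P: "fract_deriv \<delta> p = (A' * B - A * B') / B ^ 2"
    using fract_deriv[OF p(2), of \<delta> a] p(1) by (simp only: defs)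
  have Q: "fract_deriv \<delta> q = (C' * D - C * D') / D ^ 2"
    using fract_deriv[OF q(2), of \<delta> c] q(1) by (simp only: defs)
  have "p + q = Fract (a * d + c * b) (b * d)" using p q by simp
  then have "fract_deriv \<delta> (p + q) =
    ((A' * D + A * D' + (C' * B + C * B')) * (B * D) - (A * D + C * B) * (B' * D + B * D')) / (B * D) ^ 2"
    using fract_deriv[OF bd, of \<delta> "a * d + c * b"]
    by (simp only: poly_deriv_add poly_deriv_mult emb_add emb_mult defs)
  also have "\<dots> = fract_deriv \<delta> p + fract_deriv \<delta> q"
  proof -
    have n: "(A' * D + A * D' + (C' * B + C * B')) * (B * D) - (A * D + C * B) * (B' * D + B * D') =
      (A' * B - A * B') * D ^ 2 + (C' * D - C * D') * B ^ 2" by algebra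
    have r: "(x * D ^ 2 + y * B ^ 2) / (B * D) ^ 2 = x / B ^ 2 + y / D ^ 2" for x y
      using nz by (simp add: add_divide_distrib power_mult_distrib)
    show ?thesis unfolding P Q n r ..
  qed
  finally show "fract_deriv \<delta> (p + q) = fract_deriv \<delta> p + fract_deriv \<delta> q" .
  have "p * q = Fract (a * c) (b * d)" using p q by simp
  then have "fract_deriv \<delta> (p * q) =
    ((A' * C + A * C') * (B * D) - (A * C) * (B' * D + B * D')) / (B * D) ^ 2"
    using fract_deriv[OF bd, of \<delta> "a * c"]
    by (simp only: poly_deriv_add poly_deriv_mult emb_add emb_mult defs)
  also have "\<dots> = fract_deriv \<delta> p * (C / D) + (A / B) * fract_deriv \<delta> q"
  proof -
    have n: "(A' * C + A * C') * (B * D) - (A * C) * (B' * D + B * D') =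
      (A' * B - A * B') * (C * D) + A * B * (C' * D - C * D')" by algebra
    have r: "x / B ^ 2 * (C / D) = x * (C * D) / (B * D) ^ 2"
      "(A / B) * (y / D ^ 2) = A * B * y / (B * D) ^ 2" for x y
      using nz by (simp_all add: power2_eq_square)
    show ?thesis unfolding P Q n r by (rule add_divide_distrib)
  qed
  also have "C / D = q" unfolding defs q(1) by (rule Fract_eq_emb[OF q(2), symmetric])
  also have "A / B = p" unfolding defs p(1) by (rule Fract_eq_emb[OF p(2), symmetric])
  finally show "fract_deriv \<delta> (p * q) = fract_deriv \<delta> p * q + p * fract_deriv \<delta> q" .
next
  fix c
  show "fract_deriv \<delta> (cst c) = 0"
    unfolding cst_def fract_deriv_emb by (rule poly_deriv_const)
qed

lemma fract_deriv_indet: "fract_deriv \<delta> (indet v) = \<delta> v"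
  unfolding indet_def fract_deriv_emb using poly_deriv_var by simp

theorem derivation_with:
  shows "C_derivation_on UNIV (derivation_with \<delta>)" "derivation_with \<delta> (indet v) = \<delta> v"
proof -
  let ?P = "\<lambda>D. C_derivation_on UNIV D \<and> (\<forall>v. D (indet v) = \<delta> v)"
  have "?P (fract_deriv \<delta>)" using fract_deriv_derivation fract_deriv_indet by blast
  moreover have "D = fract_deriv \<delta>" if "?P D" for D
  proof
    fix p
    show "D p = fract_deriv \<delta> p"
      by (rule C_derivation_unique[of "range indet", unfolded C_adjoin_all_indets])
        (use that \<open>?P (fract_deriv \<delta>)\<close> in auto)
  qed
  ultimately have "?P (derivation_with \<delta>)"
    unfolding derivation_with_def by (rule theI)
  then show "C_derivation_on UNIV (derivation_with \<delta>)" "derivation_with \<delta> (indet v) = \<delta> v" by auto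
qed


section \<open>Substitutions are well defined\<close>

lemma subst_Fract:
  assumes "b \<noteq> 0" "poly_eval cst \<sigma> b \<noteq> 0"
  shows "subst \<sigma> (Fract a b) = poly_eval cst \<sigma> a / poly_eval cst \<sigma> b"
  unfolding subst_def
proof (rule the_equality)
  fix q
  assume "\<exists>a' b'. Fract a b = Fract a' b' \<and> b' \<noteq> 0 \<and> poly_eval cst \<sigma> b' \<noteq> 0 \<and>
    q = poly_eval cst \<sigma> a' / poly_eval cst \<sigma> b'"
  then obtain c d where cd: "Fract a b = Fract c d" "d \<noteq> 0" "poly_eval cst \<sigma> d \<noteq> 0"
    "q = poly_eval cst \<sigma> c / poly_eval cst \<sigma> d" by blast
  have "a * d = c * b" using cd assms by (simp add: eq_fract)
  then have "poly_eval cst \<sigma> a * poly_eval cst \<sigma> d = poly_eval cst \<sigma> c * poly_eval cst \<sigma> b"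
    by (metis cst.poly_eval_mult)
  then show "q = poly_eval cst \<sigma> a / poly_eval cst \<sigma> b"
    using cd assms by (simp add: frac_eq_eq)
qed (use assms in blast)

lemma subst_hom:
  assumes inj: "\<And>b. poly_eval cst \<sigma> b = 0 \<Longrightarrow> b = 0"
  shows "C_hom_on UNIV (subst \<sigma>)" "subst \<sigma> (indet v) = \<sigma> v"
proof -
  have 1: "subst \<sigma> (emb a) = poly_eval cst \<sigma> a" for a
    by (subst subst_Fract) auto
  show "subst \<sigma> (indet v) = \<sigma> v"
    unfolding indet_def 1 using cst.poly_eval_var by simp
  show "C_hom_on UNIV (subst \<sigma>)"
    unfolding C_hom_on_def
  proof (intro conjI ballI allI)
    fix p q :: ratfun
    obtain a b where p: "p = Fract a b" "b \<noteq> 0" by (cases p)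
    obtain c d where q: "q = Fract c d" "d \<noteq> 0" by (cases q)
    have bd: "b * d \<noteq> 0" using p q by simp
    have e: "poly_eval cst \<sigma> b \<noteq> 0" "poly_eval cst \<sigma> d \<noteq> 0" "poly_eval cst \<sigma> (b * d) \<noteq> 0"
      using p q bd inj by blast+
    note S = subst_Fract[OF p(2) e(1)] subst_Fract[OF q(2) e(2)] subst_Fract[OF bd e(3)]
    have "p + q = Fract (a * d + c * b) (b * d)" using p q by simp
    then show "subst \<sigma> (p + q) = subst \<sigma> p + subst \<sigma> q"
      using e by (simp add: S p(1) q(1) cst.poly_eval_add cst.poly_eval_mult divide_simps)
    have "p * q = Fract (a * c) (b * d)" using p q by simp
    then show "subst \<sigma> (p * q) = subst \<sigma> p * subst \<sigma> q"
      using e by (simp add: S p(1) q(1) cst.poly_eval_mult)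
  next
    fix c
    show "subst \<sigma> (cst c) = cst c" using 1 by (simp add: cst_def[of c] cst.poly_eval_const)
  qed
qed

theorem hom_with:
  assumes "\<And>b. poly_eval cst \<sigma> b = 0 \<Longrightarrow> b = 0"
  shows "C_hom_on UNIV (hom_with \<sigma>)" "hom_with \<sigma> (indet v) = \<sigma> v"
proof -
  let ?P = "\<lambda>f. C_hom_on UNIV f \<and> (\<forall>v. f (indet v) = \<sigma> v)"
  have "?P (subst \<sigma>)" using subst_hom[OF assms] by blast
  moreover have "f = subst \<sigma>" if "?P f" for f
  proof
    fix p
    show "f p = subst \<sigma> p"
      by (rule C_hom_unique[of "range indet", unfolded C_adjoin_all_indets])
        (use that \<open>?P (subst \<sigma>)\<close> in auto)
  qed
  ultimately have "?P (hom_with \<sigma>)"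
    unfolding hom_with_def by (rule theI)
  then show "C_hom_on UNIV (hom_with \<sigma>)" "hom_with \<sigma> (indet v) = \<sigma> v" by auto
qed


section \<open>The maps of the statement have their defining properties\<close>

lemma partial:
  "C_derivation_on UNIV partial" "partial (xv i) = xv (Suc i)" "partial (yv j i) = yv j (Suc i)"
  unfolding partial_def using derivation_with by simp_all

lemma chi:
  "C_derivation_on UNIV chi" "chi (xv i) = xv (Suc i) * phiv 1"
  "chi (yv j i) = yv j (Suc i) * phiv 1" "chi (phiv i) = phiv (Suc i)"
  unfolding chi_def using derivation_with by simp_all

text \<open>\<open>Lambda\<close> is injective on polynomials: with $\chi_0$ the derivation raising all orders by one,
  $x^{(i)} \mapsto (\frac{1}{\varphi^{(1)}}\chi_0)^i x^{(0)}$ and likewise for $y_j^{(i)}$ is a left inverse.\<close>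

lemma Lambda_val_inj:
  assumes "poly_eval cst Lambda_val b = 0"
  shows "b = 0"
proof -
  define \<chi> where "\<chi> = derivation_with (\<lambda>v. case v of
     X i \<Rightarrow> xv (Suc i) | Y j i \<Rightarrow> yv j (Suc i) | Phi i \<Rightarrow> phiv (Suc i))"
  define d where "d p = \<chi> p / phiv 1" for p
  define \<tau> where "\<tau> v = (case v of X i \<Rightarrow> (d ^^ i) (xv 0) | Y j i \<Rightarrow> (d ^^ i) (yv j 0) | Phi i \<Rightarrow> phiv i)"
    for v
  have X0: "\<chi> (xv i) = xv (Suc i)" "\<chi> (yv j i) = yv j (Suc i)" "\<chi> (phiv i) = phiv (Suc i)" for i j
    unfolding \<chi>_def using derivation_with by simp_all
  have XD: "\<chi> (p + q) = \<chi> p + \<chi> q" "\<chi> (p * q) = \<chi> p * q + p * \<chi> q" "\<chi> (cst c) = 0" for p q c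
    using derivation_with(1) unfolding \<chi>_def C_derivation_on_def by auto
  have CD: "chi (p + q) = chi p + chi q" "chi (p * q) = chi p * q + p * chi q" "chi (cst c) = 0" for p q c
    using chi(1) unfolding C_derivation_on_def by auto
  let ?e = "poly_eval cst \<tau>"
  let ?v = "\<lambda>v. Poly_Mapping.single (Poly_Mapping.single v (Suc 0)) 1 :: cpoly"
  have ev: "?e (?v v) = \<tau> v" for v by (rule cst.poly_eval_var)
  have iv: "emb (?v v) = indet v" for v by (simp add: indet_def)
  have ic: "emb (Poly_Mapping.single 0 c) = cst c" for c by (simp add: cst_def)
  note ee = cst.poly_eval_add cst.poly_eval_mult
  have phi1: "phiv (Suc 0) \<noteq> 0" by (rule indet_neq_0)
  have comm: "\<exists>c. chi (emb a) = emb c \<and> ?e c = \<chi> (?e a)" for a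
  proof (induction a rule: poly_induct)
    case (const c)
    have "chi (emb (Poly_Mapping.single 0 c)) = emb 0"
      by (simp only: ic CD) (simp add: Zero_fract_def)
    moreover have "?e 0 = \<chi> (?e (Poly_Mapping.single 0 c))"
      by (simp only: cst.poly_eval_const XD) simp
    ultimately show ?case by blast
  next
    case (var v)
    show ?case
    proof (cases v)
      case (X i)
      have "chi (emb (?v v)) = emb (?v (var.X (Suc i)) * ?v (Phi 1))"
        by (simp only: iv emb_mult X chi)
      moreover have "?e (?v (var.X (Suc i)) * ?v (Phi 1)) = \<chi> (?e (?v v))"
        using phi1 by (simp only: ev ee) (simp add: X \<tau>_def d_def)
      ultimately show ?thesis by blast
    next
      case (Y j i)
      have "chi (emb (?v v)) = emb (?v (var.Y j (Suc i)) * ?v (Phi 1))"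
        by (simp only: iv emb_mult Y chi)
      moreover have "?e (?v (var.Y j (Suc i)) * ?v (Phi 1)) = \<chi> (?e (?v v))"
        using phi1 by (simp only: ev ee) (simp add: Y \<tau>_def d_def)
      ultimately show ?thesis by blast
    next
      case (Phi i)
      have "chi (emb (?v v)) = emb (?v (var.Phi (Suc i)))"
        by (simp only: iv Phi chi)
      moreover have "?e (?v (var.Phi (Suc i))) = \<chi> (?e (?v v))"
        by (simp only: ev) (simp add: Phi \<tau>_def X0)
      ultimately show ?thesis by blast
    qed
  next
    case (add a b)
    then obtain c c' where "chi (emb a) = emb c" "?e c = \<chi> (?e a)"
      "chi (emb b) = emb c'" "?e c' = \<chi> (?e b)" by blast
    then show ?case by (intro exI[of _ "c + c'"]) (simp only: emb_add CD ee XD)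
  next
    case (mult a b)
    then obtain c c' where "chi (emb a) = emb c" "?e c = \<chi> (?e a)"
      "chi (emb b) = emb c'" "?e c' = \<chi> (?e b)" by blast
    then show ?case by (intro exI[of _ "c * b + a * c'"]) (simp only: emb_add emb_mult CD ee XD)
  qed
  have pow: "\<exists>c. (chi ^^ i) (emb a) = emb c \<and> ?e c = (\<chi> ^^ i) (?e a)" for i a
  proof (induction i)
    case (Suc i)
    then obtain c where "(chi ^^ i) (emb a) = emb c" "?e c = (\<chi> ^^ i) (?e a)" by blast
    with comm[of c] show ?case by auto
  qed auto
  have it: "(\<chi> ^^ i) (xv 0) = xv i" "(\<chi> ^^ i) (yv j 0) = yv j i" "(\<chi> ^^ i) (phiv 0) = phiv i" for i j
    by (induction i) (auto simp: X0)
  have lam: "\<exists>c. Lambda_val v = emb c \<and> ?e c = indet v" for v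
  proof (cases v)
    case (X i)
    with pow[of i "?v (var.X 0)"] show ?thesis
      unfolding ev iv by (simp add: Lambda_val_def \<tau>_def it)
  next
    case (Y j i)
    with pow[of i "?v (var.Y j 0)"] show ?thesis
      unfolding ev iv by (simp add: Lambda_val_def \<tau>_def it)
  next
    case (Phi i)
    with pow[of i "?v (var.Phi 0)"] show ?thesis
      unfolding ev iv by (simp add: Lambda_val_def \<tau>_def it)
  qed
  have "\<exists>c. poly_eval cst Lambda_val a = emb c \<and> ?e c = emb a" for a
  proof (induction a rule: poly_induct)
    case (const c)
    show ?case
      by (intro exI[of _ "Poly_Mapping.single 0 c"]) (simp only: cst.poly_eval_const ic)
  next
    case (var v)
    show ?case using lam[of v] by (simp only: cst.poly_eval_var iv)
  next
    case (add a b)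
    then obtain c c' where "poly_eval cst Lambda_val a = emb c" "?e c = emb a"
      "poly_eval cst Lambda_val b = emb c'" "?e c' = emb b" by blast
    then show ?case by (intro exI[of _ "c + c'"]) (simp only: emb_add ee)
  next
    case (mult a b)
    then obtain c c' where "poly_eval cst Lambda_val a = emb c" "?e c = emb a"
      "poly_eval cst Lambda_val b = emb c'" "?e c' = emb b" by blast
    then show ?case by (intro exI[of _ "c * c'"]) (simp only: emb_mult ee)
  qed
  then obtain c where "poly_eval cst Lambda_val b = emb c" "?e c = emb b" by blast
  then show ?thesis using assms emb_eq_0_iff by auto
qed

lemma Lambda:
  "C_hom_on UNIV Lambda" "Lambda (xv i) = (chi ^^ i) (xv 0)"
  "Lambda (yv j i) = (chi ^^ i) (yv j 0)" "Lambda (phiv i) = (chi ^^ i) (phiv 0)"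
  unfolding Lambda_def using hom_with[OF Lambda_val_inj] by (simp_all add: Lambda_val_def)

lemma indet_in_F_field: "v \<in> F_vars n \<Longrightarrow> indet v \<in> F_field n"
  unfolding F_field_def using C_adjoin_superset(1) by blast

lemma indet_in_L_field: "v \<in> L_vars n \<Longrightarrow> indet v \<in> L_field n"
  unfolding L_field_def using C_adjoin_superset(1) by blast

lemma partial_in_F_field:
  assumes "p \<in> F_field n"
  shows "partial p \<in> F_field n"
proof -
  have "partial (indet v) \<in> F_field n" if "v \<in> F_vars n" for v
    using that indet_in_F_field[of _ n] by (auto simp: F_vars_def partial)
  then show ?thesis
    using assms C_derivation_closed[OF C_derivation_on_subset[OF partial(1)]]
    unfolding F_field_def by blast
qed

lemma chi_in_L_field:
  assumes "p \<in> L_field n"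
  shows "chi p \<in> L_field n"
proof -
  note cl = is_subfield_closed[OF C_adjoin_subfield[of "indet ` L_vars n"], folded L_field_def]
  have "chi (indet v) \<in> L_field n" if "v \<in> L_vars n" for v
    using that indet_in_L_field[of _ n]
    by (auto simp: L_vars_def F_vars_def chi intro!: cl(6))
  then show ?thesis
    using assms C_derivation_closed[OF C_derivation_on_subset[OF chi(1)]]
    unfolding L_field_def by blast
qed

lemma Lambda_in_L_field:
  assumes "p \<in> L_field n"
  shows "Lambda p \<in> L_field n"
proof -
  have it: "(chi ^^ i) q \<in> L_field n" if "q \<in> L_field n" for i q
    using that by (induction i) (auto intro: chi_in_L_field)
  have "Lambda (indet v) \<in> L_field n" if "v \<in> L_vars n" for v
    using that it indet_in_L_field[of _ n] by (auto simp: L_vars_def F_vars_def Lambda)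
  moreover have "C_hom_on K Lambda" for K using Lambda(1) by (simp add: C_hom_on_def)
  ultimately show ?thesis
    using assms C_hom_closed unfolding L_field_def by blast
qed

end

(* Put nabla p = partial p / x'. On F_n we have Lambda o partial = chi o Lambda and chi = phi' partial,
   so nabla preserves geometric invariants; the kappa_{i,j} arise from y_j by iterating nabla.

   Conversely, in the coordinates x^(i), kappa_{i,j} the map Lambda keeps the curvatures and replaces
   x^(i) by chi^i(x^(0)) for i >= 1. These elements are algebraically independent over F_n, so in
   p = Lambda p they may be specialised to complex constants for which the denominator does not vanish.
   This writes p as a rational function of x^(0), y_j^(0) and the kappa_{i,j}.

   Finally i_kappa commutes with nabla and fixes x^(0) and y_j^(0), hence it fixes the whole field. *)

theory Submission
  imports Defs "HOL-Computational_Algebra.Polynomial"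
begin

hide_const (open) Rat.Fract

section \<open>Derivations and homomorphisms of the full field\<close>

lemma C_derivation_UNIV:
  assumes "C_derivation_on UNIV D"
  shows "D (p + q) = D p + D q" "D (p * q) = D p * q + p * D q" "D (cst c) = 0"
    "D 0 = 0" "D 1 = 0" "D (p - q) = D p - D q" "D (inverse p) = - D p * inverse p ^ 2"
proof -
  have K: "is_subfield UNIV" by (simp add: is_subfield_def)
  note r = C_derivation_on_rules[OF assms K UNIV_I UNIV_I]
  show "D (p + q) = D p + D q" "D (p * q) = D p * q + p * D q" "D (cst c) = 0"
    using assms by (auto simp: C_derivation_on_def)
  show "D 0 = 0" "D 1 = 0" "D (p - q) = D p - D q" "D (inverse p) = - D p * inverse p ^ 2"
    by (fact r)+
qed

lemma C_derivation_divide: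
  assumes "C_derivation_on UNIV D" "q \<noteq> 0"
  shows "D (p / q) = (D p * q - p * D q) / q ^ 2"
  using assms(2)
  by (simp add: divide_inverse C_derivation_UNIV[OF assms(1)] power2_eq_square algebra_simps)

lemma C_derivation_scale:
  assumes "C_derivation_on UNIV D"
  shows "C_derivation_on UNIV (\<lambda>p. c * D p)"
  unfolding C_derivation_on_def
  by (simp add: C_derivation_UNIV[OF assms] algebra_simps)

lemma C_hom_UNIV:
  assumes "C_hom_on UNIV f"
  shows "f (p + q) = f p + f q" "f (p * q) = f p * f q" "f (cst c) = cst c"
    "f 0 = 0" "f 1 = 1" "f (p - q) = f p - f q" "f (inverse p) = inverse (f p)"
    "f (p / q) = f p / f q"
proof -
  have K: "is_subfield UNIV" by (simp add: is_subfield_def)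
  note r = C_hom_on_rules[OF assms K UNIV_I UNIV_I]
  show m: "f (p * q) = f p * f q" for p q
    using assms by (auto simp: C_hom_on_def)
  show "f (p + q) = f p + f q" "f (cst c) = cst c"
    using assms by (auto simp: C_hom_on_def)
  show "f 0 = 0" "f 1 = 1" "f (p - q) = f p - f q" "f (inverse p) = inverse (f p)"
    by (fact r)+
  then show "f (p / q) = f p / f q" using m r(5)[of q] by (simp add: divide_inverse)
qed

lemma cst_inject: "cst a = cst b \<longleftrightarrow> a = b"
proof
  assume "cst a = cst b"
  then have "Poly_Mapping.single (0 :: var \<Rightarrow>\<^sub>0 nat) a = Poly_Mapping.single 0 b"
    by (simp add: cst_def eq_fract)
  then show "a = b" by (metis lookup_single_eq)
qed simp

lemma cst_minus_1: "cst (-1) = -1"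
  using cst.h_add[of "-1" 1] by (simp add: eq_neg_iff_add_eq_0)

lemma F_field_subfield: "is_subfield (F_field n)"
  unfolding F_field_def by (rule C_adjoin_subfield)

lemma cst_in_F_field: "cst c \<in> F_field n"
  unfolding F_field_def by (rule C_adjoin_superset)

lemma C_derivation_eq_on_F_field:
  assumes "C_derivation_on UNIV D" "C_derivation_on UNIV E"
    and "\<And>v. v \<in> F_vars n \<Longrightarrow> D (indet v) = E (indet v)" and "p \<in> F_field n"
  shows "D p = E p"
  using C_derivation_unique[OF C_derivation_on_subset[OF assms(1)] C_derivation_on_subset[OF assms(2)]]
    assms(3,4) unfolding F_field_def by blast

text \<open>The set \<open>R\<close> is only assumed closed under sums and products, so inverses may
  be missing. Its quotients form a field containing \<open>S\<close>; differences come from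
  multiplication by \<open>cst (-1)\<close>.\<close>

lemma C_adjoin_quotient:
  assumes "\<And>c. cst c \<in> R" "S \<subseteq> R" "\<And>a b. a \<in> R \<Longrightarrow> b \<in> R \<Longrightarrow> a + b \<in> R"
    "\<And>a b. a \<in> R \<Longrightarrow> b \<in> R \<Longrightarrow> a * b \<in> R" and "p \<in> C_adjoin S"
  shows "\<exists>a\<in>R. \<exists>b\<in>R. b \<noteq> 0 \<and> p = a / b"
proof -
  define K where "K = {a / b | a b. a \<in> R \<and> b \<in> R \<and> b \<noteq> 0}"
  have KI: "a / b \<in> K" if "a \<in> R" "b \<in> R" "b \<noteq> 0" for a b
    using that unfolding K_def by blast
  have KE: "\<exists>a\<in>R. \<exists>b\<in>R. b \<noteq> 0 \<and> q = a / b" if "q \<in> K" for q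
    using that unfolding K_def by blast
  have one: "1 \<in> R" and zero: "0 \<in> R"
    using assms(1)[of 1] assms(1)[of 0] by simp_all
  have diff: "a - b \<in> R" if "a \<in> R" "b \<in> R" for a b
    using assms(3)[OF that(1) assms(4)[OF assms(1)[of "-1"] that(2)]] by (simp add: cst_minus_1)
  have K1: "a \<in> K" if "a \<in> R" for a
    using KI[OF that one] by simp
  have K2: "a - b \<in> K \<and> a * b \<in> K" if ab: "a \<in> K" "b \<in> K" for a b
  proof -
    obtain r s where a: "a = r / s" "r \<in> R" "s \<in> R" "s \<noteq> 0" using KE[OF ab(1)] by blast
    obtain t u where b: "b = t / u" "t \<in> R" "u \<in> R" "u \<noteq> 0" using KE[OF ab(2)] by blast
    have "a - b = (r * u - t * s) / (s * u)" "a * b = (r * t) / (s * u)"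
      using a b by (simp_all add: diff_frac_eq)
    moreover have "r * u - t * s \<in> R" "r * t \<in> R" "s * u \<in> R" "s * u \<noteq> 0"
      using a b by (simp_all add: assms(4) diff)
    ultimately show ?thesis using KI by simp
  qed
  have K3: "inverse a \<in> K" if a_K: "a \<in> K" for a
  proof (cases "a = 0")
    case True
    then show ?thesis using K1[OF zero] by simp
  next
    case False
    obtain r s where a: "a = r / s" "r \<in> R" "s \<in> R" "s \<noteq> 0" using KE[OF a_K] by blast
    then have "r \<noteq> 0" using False by auto
    then show ?thesis using KI[OF a(3,2)] a(1) by simp
  qed
  have "is_subfield K"
    unfolding is_subfield_def using K1[OF one] K2 K3 by simp
  moreover have "range cst \<subseteq> K" "S \<subseteq> K" using K1 assms(1,2) by auto
  ultimately have "p \<in> K" using C_adjoin_minimal assms(5) by blast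
  then show ?thesis by (rule KE)
qed


section \<open>Substitutions\<close>

lemma subst_emb:
  shows "emb a \<in> subst_dom \<sigma>" "subst \<sigma> (emb a) = poly_eval cst \<sigma> a"
proof -
  show "emb a \<in> subst_dom \<sigma>"
    unfolding subst_dom_def by (intro CollectI exI[of _ a] exI[of _ 1]) simp
  show "subst \<sigma> (emb a) = poly_eval cst \<sigma> a"
    using subst_Fract[of 1 \<sigma> a] by simp
qed

lemma subst_cst: "cst c \<in> subst_dom \<sigma>" "subst \<sigma> (cst c) = cst c"
  using subst_emb[where a = "Poly_Mapping.single 0 c" and \<sigma> = \<sigma>] by (simp_all add: cst_def[of c] cst.poly_eval_const)

lemma subst_indet: "indet v \<in> subst_dom \<sigma>" "subst \<sigma> (indet v) = \<sigma> v"
  using subst_emb[where a = "Poly_Mapping.single (Poly_Mapping.single v (Suc 0)) 1" and \<sigma> = \<sigma>]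
  unfolding cst.poly_eval_var by (simp_all add: indet_def)

lemma subst_arith:
  assumes "p \<in> subst_dom \<sigma>" "q \<in> subst_dom \<sigma>"
  shows "p + q \<in> subst_dom \<sigma>" "subst \<sigma> (p + q) = subst \<sigma> p + subst \<sigma> q"
    "p * q \<in> subst_dom \<sigma>" "subst \<sigma> (p * q) = subst \<sigma> p * subst \<sigma> q"
    "p - q \<in> subst_dom \<sigma>" "subst \<sigma> (p - q) = subst \<sigma> p - subst \<sigma> q"
proof -
  have main: "p + q \<in> subst_dom \<sigma> \<and> subst \<sigma> (p + q) = subst \<sigma> p + subst \<sigma> q \<and>
    p * q \<in> subst_dom \<sigma> \<and> subst \<sigma> (p * q) = subst \<sigma> p * subst \<sigma> q"
    if "p \<in> subst_dom \<sigma>" "q \<in> subst_dom \<sigma>" for p q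
  proof -
    obtain a b where p: "p = Fract a b" "b \<noteq> 0" "poly_eval cst \<sigma> b \<noteq> 0"
      using \<open>p \<in> subst_dom \<sigma>\<close> unfolding subst_dom_def by blast
    obtain c d where q: "q = Fract c d" "d \<noteq> 0" "poly_eval cst \<sigma> d \<noteq> 0"
      using \<open>q \<in> subst_dom \<sigma>\<close> unfolding subst_dom_def by blast
    have bd: "b * d \<noteq> 0" "poly_eval cst \<sigma> (b * d) \<noteq> 0" using p q by (simp_all add: cst.poly_eval_mult)
    have s: "p + q = Fract (a * d + c * b) (b * d)" and m: "p * q = Fract (a * c) (b * d)"
      using p q by simp_all
    have "p + q \<in> subst_dom \<sigma>" "p * q \<in> subst_dom \<sigma>"
      unfolding s m subst_dom_def using bd by blast+
    moreover have "subst \<sigma> (p + q) = subst \<sigma> p + subst \<sigma> q"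
      unfolding s subst_Fract[OF bd] unfolding p(1) q(1) subst_Fract[OF p(2,3)] subst_Fract[OF q(2,3)]
      using p q by (simp add: cst.poly_eval_add cst.poly_eval_mult divide_simps)
    moreover have "subst \<sigma> (p * q) = subst \<sigma> p * subst \<sigma> q"
      unfolding m subst_Fract[OF bd] unfolding p(1) q(1) subst_Fract[OF p(2,3)] subst_Fract[OF q(2,3)]
      using p q by (simp add: cst.poly_eval_mult)
    ultimately show ?thesis by blast
  qed
  show "p + q \<in> subst_dom \<sigma>" "subst \<sigma> (p + q) = subst \<sigma> p + subst \<sigma> q"
    "p * q \<in> subst_dom \<sigma>" "subst \<sigma> (p * q) = subst \<sigma> p * subst \<sigma> q"
    using main[OF assms] by blast+
  have n: "cst (-1) * q \<in> subst_dom \<sigma>" "subst \<sigma> (cst (-1) * q) = cst (-1) * subst \<sigma> q"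
    using main[OF subst_cst(1)[of "-1"] assms(2)] subst_cst(2) by simp_all
  show "p - q \<in> subst_dom \<sigma>" "subst \<sigma> (p - q) = subst \<sigma> p - subst \<sigma> q"
    using main[OF assms(1) n(1)] n(2) by (simp_all add: cst_minus_1)
qed

lemma subst_inverse:
  assumes "p \<in> subst_dom \<sigma>" "subst \<sigma> p \<noteq> 0"
  shows "inverse p \<in> subst_dom \<sigma>" "subst \<sigma> (inverse p) = inverse (subst \<sigma> p)"
proof -
  obtain a b where p: "p = Fract a b" "b \<noteq> 0" "poly_eval cst \<sigma> b \<noteq> 0"
    using assms(1) unfolding subst_dom_def by blast
  have a: "poly_eval cst \<sigma> a \<noteq> 0" using assms(2) p by (auto simp: subst_Fract)
  then have a': "a \<noteq> 0" by auto
  have i: "inverse p = Fract b a" using p by simp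
  show "inverse p \<in> subst_dom \<sigma>" unfolding i subst_dom_def using a a' by blast
  show "subst \<sigma> (inverse p) = inverse (subst \<sigma> p)"
    unfolding i subst_Fract[OF a' a] unfolding p(1) subst_Fract[OF p(2,3)] by simp
qed

lemma subst_divide:
  assumes "p \<in> subst_dom \<sigma>" "q \<in> subst_dom \<sigma>" "subst \<sigma> q \<noteq> 0"
  shows "p / q \<in> subst_dom \<sigma>" "subst \<sigma> (p / q) = subst \<sigma> p / subst \<sigma> q"
  unfolding divide_inverse
  using subst_arith(3,4)[OF assms(1) subst_inverse(1)[OF assms(2,3)]] subst_inverse(2)[OF assms(2,3)]
  by simp_all

text \<open>The domain itself need not be closed under inverses. A fixed nonzero element, however,
  has a nonzero image, so its inverse stays in the domain.\<close>

lemma subst_fixed_subfield: "is_subfield {p \<in> subst_dom \<sigma>. subst \<sigma> p = p}"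
  unfolding is_subfield_def
proof (intro conjI ballI)
  show "1 \<in> {p \<in> subst_dom \<sigma>. subst \<sigma> p = p}" using subst_cst[where c = 1 and \<sigma> = \<sigma>] by simp
next
  fix p assume p: "p \<in> {p \<in> subst_dom \<sigma>. subst \<sigma> p = p}"
  show "inverse p \<in> {p \<in> subst_dom \<sigma>. subst \<sigma> p = p}"
    using p subst_inverse[where p = p and \<sigma> = \<sigma>] by (cases "p = 0") auto
qed (auto simp: subst_arith)

lemma subst_fixes_C_adjoin:
  assumes "\<And>s. s \<in> S \<Longrightarrow> s \<in> subst_dom \<sigma> \<and> subst \<sigma> s = s" "p \<in> C_adjoin S"
  shows "p \<in> subst_dom \<sigma>" "subst \<sigma> p = p"
  using C_adjoin_minimal[OF subst_fixed_subfield[of \<sigma>], of S] assms subst_cst by blast+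

lemma subst_fixes_F_field:
  assumes "\<And>v. v \<in> F_vars n \<Longrightarrow> \<sigma> v = indet v" "p \<in> F_field n"
  shows "p \<in> subst_dom \<sigma>" "subst \<sigma> p = p"
proof -
  have "s \<in> subst_dom \<sigma> \<and> subst \<sigma> s = s" if "s \<in> indet ` F_vars n" for s
    using that assms(1) subst_indet by auto
  then show "p \<in> subst_dom \<sigma>" "subst \<sigma> p = p"
    using subst_fixes_C_adjoin assms(2) unfolding F_field_def by blast+
qed

lemma subst_poly_eval:
  assumes "\<And>v. \<tau> v \<in> subst_dom \<sigma>"
  shows "poly_eval cst \<tau> a \<in> subst_dom \<sigma> \<and>
    subst \<sigma> (poly_eval cst \<tau> a) = poly_eval cst (\<lambda>v. subst \<sigma> (\<tau> v)) a"
proof (induction a rule: poly_induct)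
  case (const c)
  then show ?case by (simp add: cst.poly_eval_const subst_cst)
next
  case (var v)
  then show ?case unfolding cst.poly_eval_var using assms by blast
next
  case (add a b)
  then show ?case by (simp add: cst.poly_eval_add subst_arith)
next
  case (mult a b)
  then show ?case by (simp add: cst.poly_eval_mult subst_arith)
qed

lemma poly_eval_in_subfield:
  assumes "is_subfield K" "range cst \<subseteq> K" "\<And>v. \<tau> v \<in> K"
  shows "poly_eval cst \<tau> a \<in> K"
proof (induction a rule: poly_induct)
  case (const c)
  then show ?case using assms(2) by (auto simp: cst.poly_eval_const)
next
  case (var v)
  then show ?case unfolding cst.poly_eval_var by (rule assms)
qed (auto simp: cst.poly_eval_add cst.poly_eval_mult is_subfield_closed[OF assms(1)])

text \<open>Both composites obey the same Leibniz rule along \<open>\<sigma>\<close>, so agreement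
  on indeterminates extends to polynomials. The quotient rule extends it to
  \<open>subst_dom \<sigma>\<close>, since the squared denominator still does not vanish.\<close>

lemma subst_derivation:
  assumes D: "C_derivation_on UNIV D" and E: "C_derivation_on UNIV E"
    and v: "\<And>v. D (indet v) \<in> subst_dom \<sigma>" "\<And>v. subst \<sigma> (D (indet v)) = E (\<sigma> v)"
    and p: "p \<in> subst_dom \<sigma>"
  shows "D p \<in> subst_dom \<sigma>" "subst \<sigma> (D p) = E (subst \<sigma> p)"
proof -
  have P: "D (emb a) \<in> subst_dom \<sigma> \<and> subst \<sigma> (D (emb a)) = E (subst \<sigma> (emb a))" for a
  proof (induction a rule: poly_induct)
    case (const c)
    have "D (cst c) \<in> subst_dom \<sigma> \<and> subst \<sigma> (D (cst c)) = E (subst \<sigma> (cst c))"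
      using subst_cst[where c = 0 and \<sigma> = \<sigma>] subst_cst[where c = c and \<sigma> = \<sigma>] by (simp add: C_derivation_UNIV[OF D] C_derivation_UNIV[OF E])
    then show ?case by (simp add: cst_def)
  next
    case (var w)
    show ?case using v[of w] subst_indet[where v = w and \<sigma> = \<sigma>] by (simp add: indet_def)
  next
    case (add a b)
    then show ?case unfolding emb_add
      by (simp only: C_derivation_UNIV[OF D] C_derivation_UNIV[OF E] subst_arith subst_emb(1) simp_thms)
  next
    case (mult a b)
    then show ?case unfolding emb_mult
      by (simp only: C_derivation_UNIV[OF D] C_derivation_UNIV[OF E] subst_arith subst_emb(1) simp_thms)
  qed
  obtain a b where ab: "p = Fract a b" "b \<noteq> 0" "poly_eval cst \<sigma> b \<noteq> 0"
    using p unfolding subst_dom_def by blast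
  define A B where "A = emb a" "B = emb b"
  have pAB: "p = A / B" unfolding A_B_def ab(1) by (rule Fract_eq_emb[OF ab(2)])
  have B: "B \<noteq> 0" "subst \<sigma> B \<noteq> 0" using ab by (simp_all only: A_B_def emb_eq_0_iff subst_emb not_False_eq_True)
  have d: "A \<in> subst_dom \<sigma>" "B \<in> subst_dom \<sigma>" "D A \<in> subst_dom \<sigma>" "D B \<in> subst_dom \<sigma>"
    using P subst_emb(1) by (simp_all only: A_B_def)
  have s: "subst \<sigma> (D A) = E (subst \<sigma> A)" "subst \<sigma> (D B) = E (subst \<sigma> B)"
    using P by (simp_all only: A_B_def)
  have n: "D A * B - A * D B \<in> subst_dom \<sigma>" "B ^ 2 \<in> subst_dom \<sigma>"
    using d by (auto simp: power2_eq_square intro!: subst_arith)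
  have sB: "subst \<sigma> (B ^ 2) = (subst \<sigma> B) ^ 2"
    using d by (simp add: power2_eq_square subst_arith)
  then have B2: "subst \<sigma> (B ^ 2) \<noteq> 0" using B by simp
  have sn: "subst \<sigma> (D A * B - A * D B) = E (subst \<sigma> A) * subst \<sigma> B - subst \<sigma> A * E (subst \<sigma> B)"
    using d by (simp add: subst_arith s)
  have Dp: "D p = (D A * B - A * D B) / B ^ 2"
    unfolding pAB by (rule C_derivation_divide[OF D B(1)])
  show "D p \<in> subst_dom \<sigma>" unfolding Dp by (rule subst_divide[OF n B2])
  have sp: "subst \<sigma> p = subst \<sigma> A / subst \<sigma> B" unfolding pAB using d B(2) by (simp add: subst_divide)
  show "subst \<sigma> (D p) = E (subst \<sigma> p)"
    unfolding Dp sp subst_divide(2)[OF n B2] sn sB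
    by (rule C_derivation_divide[OF E B(2), symmetric])
qed

section \<open>Specialisation of values to complex constants\<close>

lemma poly_eval_cong:
  fixes a :: cpoly
  assumes "\<And>m v. m \<in> Poly_Mapping.keys a \<Longrightarrow> v \<in> Poly_Mapping.keys m \<Longrightarrow> \<sigma> v = \<tau> v"
  shows "poly_eval h \<sigma> a = poly_eval h \<tau> a"
  unfolding poly_eval_def monom_eval_def using assms by (intro sum.cong prod.cong arg_cong2[where f = "(*)"]) auto

text \<open>As a function of the value of \<open>u\<close>, the evaluation is a nonzero univariate polynomial.\<close>

lemma poly_eval_specialise_one:
  assumes "poly_eval cst \<sigma> f \<noteq> 0"
  shows "\<exists>c. poly_eval cst (\<sigma>(u := cst c)) f \<noteq> 0"
proof -
  interpret pc: coeff_hom "\<lambda>c. [:cst c:]"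
    by unfold_locales (simp_all add: cst.h_add cst.h_mult)
  let ?\<tau> = "\<lambda>v. if v = u then [:0, 1:] else [:\<sigma> v:]"
  let ?F = "poly_eval (\<lambda>c. [:cst c:]) ?\<tau> f"
  have ev: "poly (poly_eval (\<lambda>c. [:cst c:]) ?\<tau> a) z = poly_eval cst (\<sigma>(u := z)) a" for z a
  proof (induction a rule: poly_induct)
    case (const c)
    then show ?case by (simp add: cst.poly_eval_const pc.poly_eval_const)
  next
    case (var v)
    then show ?case unfolding cst.poly_eval_var pc.poly_eval_var by simp
  qed (simp_all add: cst.poly_eval_add pc.poly_eval_add cst.poly_eval_mult pc.poly_eval_mult)
  \<comment> \<open>At the original value \<open>\<sigma> u\<close> the polynomial \<open>?F\<close>
    returns the given nonzero evaluation.\<close>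
  have "?F \<noteq> 0" using ev[of f "\<sigma> u"] assms by auto
  then have "finite {z. poly ?F z = 0}" by (rule poly_roots_finite)
  moreover have "infinite (range cst)"
    using infinite_UNIV_char_0[where 'a = complex] by (simp add: finite_image_iff inj_on_def cst_inject)
  ultimately have "\<not> range cst \<subseteq> {z. poly ?F z = 0}" using finite_subset by blast
  then obtain z where "z \<in> range cst" "poly ?F z \<noteq> 0" by blast
  then show ?thesis unfolding ev by blast
qed

text \<open>Constants are chosen for one variable at a time, each choice keeping the evaluation
  nonzero. A finite \<open>A\<close> is enough because a polynomial contains only finitely many
  indeterminates.\<close>

lemma poly_eval_specialise:
  assumes "finite A" "poly_eval cst \<sigma> f \<noteq> 0"
  shows "\<exists>c. poly_eval cst (\<lambda>v. if v \<in> A then cst (c v) else \<sigma> v) f \<noteq> 0"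
  using assms(1)
proof induction
  case empty
  then show ?case using assms(2) by simp
next
  case (insert u A)
  then obtain c where "poly_eval cst (\<lambda>v. if v \<in> A then cst (c v) else \<sigma> v) f \<noteq> 0" by blast
  then obtain z where z: "poly_eval cst ((\<lambda>v. if v \<in> A then cst (c v) else \<sigma> v)(u := cst z)) f \<noteq> 0"
    using poly_eval_specialise_one by blast
  have "(\<lambda>v. if v \<in> A then cst (c v) else \<sigma> v)(u := cst z) =
    (\<lambda>v. if v \<in> insert u A then cst ((c(u := z)) v) else \<sigma> v)" by auto
  with z show ?case by metis
qed


section \<open>Algebraic curvatures\<close>

lemma F_vars_Y [simp]: "Y j i \<in> F_vars n \<longleftrightarrow> 1 \<le> j \<and> j \<le> n"
  by (auto simp: F_vars_def)

lemma F_vars_X [simp]: "X i \<in> F_vars n"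
  by (auto simp: F_vars_def)

lemma xv1_neq_0 [simp]: "xv (Suc 0) \<noteq> 0"
  by (rule indet_neq_0)

text \<open>By the quotient rule the separate formula for the first curvatures is the derivative of
  the slopes divided by \<open>xv 1\<close>, so one recursion covers all orders.\<close>

lemma kappa_Suc: "kappa (Suc i) j = partial (kappa i j) / xv 1"
proof (cases i)
  case 0
  then show ?thesis
    by (simp add: C_derivation_divide[OF partial(1)] partial power2_eq_square power3_eq_cube numeral_2_eq_2)
qed simp

lemma kappa_in_F_field:
  assumes "1 \<le> j" "j \<le> n"
  shows "kappa i j \<in> F_field n"
proof (induction i)
  case 0
  show ?case using assms
    by (auto intro!: is_subfield_closed(8)[OF F_field_subfield] indet_in_F_field)
next
  case (Suc i)
  then show ?case unfolding kappa_Suc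
    by (intro is_subfield_closed(8)[OF F_field_subfield] indet_in_F_field partial_in_F_field) auto
qed

text \<open>This is differentiation with respect to \<open>xv 0\<close> along the curve: it sends
  \<open>xv 0\<close> to 1.\<close>

lemma nabla: "C_derivation_on UNIV (\<lambda>p. partial p / xv 1)"
  using C_derivation_scale[OF partial(1), of "inverse (xv 1)"] by (simp add: divide_inverse mult.commute)

text \<open>The substitution \<open>i_kappa\<close> commutes with \<open>\<lambda>p. partial p / xv 1\<close>, which generates all
  curvatures from $y_j^{(0)}$.\<close>

lemma i_kappa_nabla:
  assumes "p \<in> i_kappa_dom"
  shows "partial p / xv 1 \<in> i_kappa_dom" "i_kappa (partial p / xv 1) = partial (i_kappa p) / xv 1"
proof -
  have x1: "subst i_kappa_val (xv 1) = 1" by (simp add: subst_indet)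
  \<comment> \<open>For \<open>X 0\<close> both sides are 1, for higher \<open>X i\<close> and for
    \<open>Phi i\<close> they are 0. For \<open>Y j i\<close> they are \<open>kappa i j\<close>, by
    the recursion or, at \<open>i = 0\<close>, by the definition of the slopes.\<close>
  have P: "partial (indet v) \<in> subst_dom i_kappa_val \<and>
    subst i_kappa_val (partial (indet v)) = partial (i_kappa_val v) / xv 1" for v
  proof (cases v)
    case (X i)
    then show ?thesis
      by (simp add: partial subst_indet C_derivation_UNIV[OF partial(1)])
  next
    case (Y j i)
    then show ?thesis
      by (cases i) (simp_all add: partial subst_indet kappa_Suc del: kappa.simps(2,3))
  next
    case (Phi i)
    then show ?thesis using subst_cst[where c = 0 and \<sigma> = i_kappa_val]
      by (simp add: partial_def derivation_with)
  qed
  have Q: "partial (indet v) / xv 1 \<in> subst_dom i_kappa_val"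
    "subst i_kappa_val (partial (indet v) / xv 1) = partial (i_kappa_val v) / xv 1" for v
    using subst_divide[OF conjunct1[OF P] subst_indet(1), of "X 1" v] P[of v] x1 by simp_all
  show "partial p / xv 1 \<in> i_kappa_dom" "i_kappa (partial p / xv 1) = partial (i_kappa p) / xv 1"
    using subst_derivation[OF nabla nabla Q] assms unfolding i_kappa_dom_def i_kappa_def by blast+
qed

lemma i_kappa_kappa: "kappa i j \<in> i_kappa_dom \<and> i_kappa (kappa i j) = kappa i j"
proof (induction i)
  case 0
  \<comment> \<open>The induction starts below the slopes: \<open>kappa 0 j\<close> is already one
    application of the derivation to \<open>yv j 0\<close>.\<close>
  have "yv j 0 \<in> i_kappa_dom" "i_kappa (yv j 0) = yv j 0"
    by (simp_all add: i_kappa_dom_def i_kappa_def subst_indet)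
  with i_kappa_nabla[of "yv j 0"] show ?case by (simp add: partial)
next
  case (Suc i)
  then show ?case using i_kappa_nabla[of "kappa i j"] unfolding kappa_Suc by simp
qed


section \<open>Curvatures are geometric invariants\<close>

text \<open>\<open>Lambda\<close> is built from powers of \<open>chi\<close>, and
  \<open>partial\<close> raises the order by one, so both sides agree on the generators. The
  identity is confined to \<open>F_field n\<close>: \<open>partial\<close> kills
  \<open>phiv i\<close>, whereas \<open>chi\<close> does not.\<close>

lemma Lambda_partial:
  assumes "p \<in> F_field n"
  shows "Lambda (partial p) = chi (Lambda p)"
proof -
  note L = C_hom_UNIV[OF Lambda(1)]
  note P = C_derivation_UNIV[OF partial(1)]
  note C = C_derivation_UNIV[OF chi(1)]
  let ?K = "{p. Lambda (partial p) = chi (Lambda p)}"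
  have "C_adjoin (indet ` F_vars n) \<subseteq> ?K"
  proof (rule C_adjoin_minimal)
    have "Lambda (partial (inverse a)) = chi (Lambda (inverse a))"
      if "Lambda (partial a) = chi (Lambda a)" for a
    proof -
      have "Lambda (- q) = - Lambda q" for q
        using L(6)[of 0 q] L(4) by simp
      then show ?thesis using that by (simp add: L P C power2_eq_square)
    qed
    then show "is_subfield ?K" unfolding is_subfield_def
      by (simp add: L(1,2,4-6) P(1,2,4-6) C(1,2,4-6))
    show "range cst \<subseteq> ?K" by (auto simp: L P C)
    show "indet ` F_vars n \<subseteq> ?K" by (auto simp: F_vars_def partial Lambda)
  qed
  then show ?thesis using assms unfolding F_field_def by blast
qed

lemma chi_eq_partial:
  assumes "p \<in> F_field n"
  shows "chi p = phiv 1 * partial p"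
  by (rule C_derivation_eq_on_F_field[OF chi(1) C_derivation_scale[OF partial(1)] _ assms])
    (auto simp: F_vars_def chi partial)

lemma geometric_invariants_subfield: "is_subfield (geometric_invariants n)"
  unfolding geometric_invariants_def is_subfield_def
  by (simp add: C_hom_UNIV[OF Lambda(1)] is_subfield_closed[OF F_field_subfield])

text \<open>By the chain rule \<open>Lambda\<close> multiplies both \<open>partial p\<close> and
  \<open>xv 1\<close> by \<open>phiv 1\<close>, and the factor cancels in the quotient.\<close>

lemma geometric_invariants_nabla:
  assumes "p \<in> geometric_invariants n"
  shows "partial p / xv 1 \<in> geometric_invariants n"
proof -
  have p: "p \<in> F_field n" "Lambda p = p" using assms by (auto simp: geometric_invariants_def)
  have "Lambda (partial p / xv 1) = phiv 1 * partial p / (xv 1 * phiv 1)"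
    using p by (simp add: C_hom_UNIV[OF Lambda(1)] Lambda_partial chi_eq_partial Lambda chi)
  also have "\<dots> = partial p / xv 1" using indet_neq_0[of "Phi 1"] by simp
  finally show ?thesis using p unfolding geometric_invariants_def
    by (auto intro!: is_subfield_closed(8)[OF F_field_subfield] partial_in_F_field indet_in_F_field)
qed

lemma kappa_geometric_invariant:
  assumes "1 \<le> j" "j \<le> n"
  shows "kappa i j \<in> geometric_invariants n"
proof (induction i)
  case 0
  have "yv j 0 \<in> geometric_invariants n"
    using assms by (auto simp: geometric_invariants_def Lambda intro: indet_in_F_field)
  from geometric_invariants_nabla[OF this] show ?case by (simp add: partial)
next
  case (Suc i)
  then show ?case unfolding kappa_Suc by (rule geometric_invariants_nabla)
qed


section \<open>Geometric invariants are rational in the curvatures\<close>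

text \<open>Here \<open>phiv i\<close> plays the role of $\chi^i(x^{(0)})$ for $i \ge 1$, and \<open>free_chi\<close> is $\chi$
  expressed in these coordinates.\<close>

definition free_chi :: "ratfun \<Rightarrow> ratfun" where
  "free_chi = derivation_with (\<lambda>v. case v of
     X i \<Rightarrow> xv (Suc i) * (phiv 1 / xv 1) | Y j i \<Rightarrow> yv j (Suc i) * (phiv 1 / xv 1)
   | Phi i \<Rightarrow> if i = 0 then phiv 1 / xv 1 else phiv (Suc i))"

text \<open>The substitution passing to the new coordinates. Solving
  \<open>chi (xv 0) = xv 1 * phiv 1\<close> for the last factor gives the value
  \<open>phiv 1 / xv 1\<close> at \<open>Phi 1\<close>; higher orders follow by applying
  \<open>free_chi\<close>.\<close>

definition free_val :: "var \<Rightarrow> ratfun" where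
  "free_val v = (case v of X i \<Rightarrow> xv i | Y j i \<Rightarrow> yv j i | Phi i \<Rightarrow> (free_chi ^^ i) (phiv 0))"

text \<open>Variables outside \<open>F_vars n\<close> are sent to \<open>0\<close>, so that every polynomial is evaluated in the
  field generated by the curvatures and the \<open>g i\<close>.\<close>

definition curv_val :: "nat \<Rightarrow> (nat \<Rightarrow> ratfun) \<Rightarrow> var \<Rightarrow> ratfun" where
  "curv_val n g v = (case v of
     X i \<Rightarrow> if i = 0 then xv 0 else g i
   | Y j i \<Rightarrow> if 1 \<le> j \<and> j \<le> n then i_kappa_val (Y j i) else 0
   | Phi i \<Rightarrow> 0)"

lemma free_chi:
  "C_derivation_on UNIV free_chi" "free_chi (xv i) = xv (Suc i) * (phiv 1 / xv 1)"
  "free_chi (yv j i) = yv j (Suc i) * (phiv 1 / xv 1)" "free_chi (phiv 0) = phiv 1 / xv 1"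
  "i \<noteq> 0 \<Longrightarrow> free_chi (phiv i) = phiv (Suc i)"
  unfolding free_chi_def using derivation_with by simp_all

lemma free_chi_eq_partial:
  assumes "p \<in> F_field n"
  shows "free_chi p = phiv 1 / xv 1 * partial p"
  by (rule C_derivation_eq_on_F_field[OF free_chi(1) C_derivation_scale[OF partial(1)] _ assms])
    (auto simp: F_vars_def free_chi partial)

text \<open>In the first step \<open>xv 1\<close> cancels and leaves \<open>phiv 1\<close>;
  afterwards \<open>free_chi\<close> raises the order.\<close>

lemma free_chi_pow_xv: "(free_chi ^^ Suc i) (xv 0) = phiv (Suc i)"
  by (induction i) (simp_all add: free_chi)

lemma free_val_F_vars: "v \<in> F_vars n \<Longrightarrow> free_val v = indet v"
  by (auto simp: F_vars_def free_val_def)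

lemma subst_free_val_chi:
  assumes "p \<in> subst_dom free_val"
  shows "chi p \<in> subst_dom free_val" "subst free_val (chi p) = free_chi (subst free_val p)"
proof -
  have P: "chi (indet v) \<in> subst_dom free_val \<and> subst free_val (chi (indet v)) = free_chi (free_val v)" for v
    by (cases v) (simp_all add: chi subst_arith subst_indet free_val_def free_chi)
  show "chi p \<in> subst_dom free_val" "subst free_val (chi p) = free_chi (subst free_val p)"
    using subst_derivation[OF chi(1) free_chi(1) conjunct1[OF P] conjunct2[OF P] assms] by blast+
qed

lemma subst_free_val_chi_pow:
  assumes "v \<in> F_vars n"
  shows "(chi ^^ i) (indet v) \<in> subst_dom free_val \<and>
    subst free_val ((chi ^^ i) (indet v)) = (free_chi ^^ i) (indet v)"
  by (induction i) (simp_all add: subst_free_val_chi subst_indet free_val_F_vars[OF assms])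

text \<open>The witness comes from one formal derivation, sending \<open>X i\<close> to
  \<open>X (Suc i)\<close> and, for admissible \<open>j\<close>, \<open>Y j i\<close> to
  \<open>Y j (Suc i) * X 1\<close>. It becomes \<open>partial\<close> in the coordinates
  \<open>xv\<close> and \<open>free_chi\<close> in the coordinates \<open>phiv\<close>.\<close>

lemma curv_val_derivation:
  "\<exists>C. poly_eval cst (curv_val n xv) C = partial (poly_eval cst (curv_val n xv) B) \<and>
    poly_eval cst (curv_val n phiv) C = free_chi (poly_eval cst (curv_val n phiv) B)"
proof (induction B rule: poly_induct)
  note P = C_derivation_UNIV[OF partial(1)]
  note F = C_derivation_UNIV[OF free_chi(1)]
  {
    case (const c)
    then show ?case by (intro exI[of _ 0]) (simp add: cst.poly_eval_const P F)
  next
    case (add a b)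
    then obtain c d where
      "poly_eval cst (curv_val n xv) c = partial (poly_eval cst (curv_val n xv) a)"
      "poly_eval cst (curv_val n phiv) c = free_chi (poly_eval cst (curv_val n phiv) a)"
      "poly_eval cst (curv_val n xv) d = partial (poly_eval cst (curv_val n xv) b)"
      "poly_eval cst (curv_val n phiv) d = free_chi (poly_eval cst (curv_val n phiv) b)" by blast
    then show ?case by (intro exI[of _ "c + d"]) (simp add: cst.poly_eval_add P F)
  next
    case (mult a b)
    then obtain c d where
      "poly_eval cst (curv_val n xv) c = partial (poly_eval cst (curv_val n xv) a)"
      "poly_eval cst (curv_val n phiv) c = free_chi (poly_eval cst (curv_val n phiv) a)"
      "poly_eval cst (curv_val n xv) d = partial (poly_eval cst (curv_val n xv) b)"
      "poly_eval cst (curv_val n phiv) d = free_chi (poly_eval cst (curv_val n phiv) b)" by blast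
    then show ?case by (intro exI[of _ "c * b + a * d"])
      (simp add: cst.poly_eval_add cst.poly_eval_mult P F)
  next
    case (var v)
    let ?v = "\<lambda>v. Poly_Mapping.single (Poly_Mapping.single v (Suc 0)) 1 :: cpoly"
    show ?case unfolding cst.poly_eval_var
    proof (cases v)
      case (X i)
      then show "\<exists>C. poly_eval cst (curv_val n xv) C = partial (curv_val n xv v) \<and>
        poly_eval cst (curv_val n phiv) C = free_chi (curv_val n phiv v)"
        by (intro exI[of _ "?v (var.X (Suc i))"], unfold cst.poly_eval_var)
          (simp add: curv_val_def partial free_chi)
    next
      case (Y j i)
      show "\<exists>C. poly_eval cst (curv_val n xv) C = partial (curv_val n xv v) \<and>
        poly_eval cst (curv_val n phiv) C = free_chi (curv_val n phiv v)"
      proof (cases "1 \<le> j \<and> j \<le> n")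
        case True
        have "partial (i_kappa_val v) = i_kappa_val (var.Y j (Suc i)) * xv 1"
          unfolding Y by (cases i) (simp_all add: partial kappa_Suc del: kappa.simps(2,3))
        moreover have "i_kappa_val v \<in> F_field n"
          unfolding Y using True kappa_in_F_field by (auto intro: indet_in_F_field)
        then have "free_chi (i_kappa_val v) = phiv 1 / xv 1 * partial (i_kappa_val v)"
          by (rule free_chi_eq_partial)
        \<comment> \<open>The value of \<open>X 1\<close> is \<open>xv 1\<close> or
          \<open>phiv 1\<close>: the first undoes the division in the curvature recursion, the
          second remains after \<open>xv 1\<close> cancels in \<open>free_chi\<close>.\<close>
        ultimately show ?thesis using True Y
          by (intro exI[of _ "?v (var.Y j (Suc i)) * ?v (var.X 1)"], unfold cst.poly_eval_mult cst.poly_eval_var)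
            (simp add: curv_val_def)
      next
        case False
        then have "curv_val n g v = 0" for g by (auto simp: curv_val_def Y)
        then show ?thesis by (intro exI[of _ 0]) (simp add: P F)
      qed
    next
      case (Phi i)
      then show "\<exists>C. poly_eval cst (curv_val n xv) C = partial (curv_val n xv v) \<and>
        poly_eval cst (curv_val n phiv) C = free_chi (curv_val n phiv v)"
        by (intro exI[of _ 0]) (simp add: curv_val_def P F)
    qed
  }
qed

text \<open>Formal differentiation of \<open>Y j 0\<close> yields a polynomial that describes
  \<open>yv j i\<close> in the old coordinates and its image under \<open>Lambda\<close> in the new
  ones.\<close>

lemma curv_val_yv:
  assumes "1 \<le> j" "j \<le> n"
  shows "\<exists>B. poly_eval cst (curv_val n xv) B = yv j i \<and>
    poly_eval cst (curv_val n phiv) B = (free_chi ^^ i) (yv j 0)"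
proof (induction i)
  case 0
  show ?case
    by (intro exI[of _ "Poly_Mapping.single (Poly_Mapping.single (Y j 0) (Suc 0)) 1"],
      unfold cst.poly_eval_var) (use assms in \<open>simp add: curv_val_def\<close>)
next
  case (Suc i)
  then obtain B where B: "poly_eval cst (curv_val n xv) B = yv j i"
    "poly_eval cst (curv_val n phiv) B = (free_chi ^^ i) (yv j 0)" by (elim exE conjE)
  obtain C where C: "poly_eval cst (curv_val n xv) C = partial (yv j i)"
    "poly_eval cst (curv_val n phiv) C = free_chi ((free_chi ^^ i) (yv j 0))"
    using curv_val_derivation[of n B] unfolding B by (elim exE conjE)
  show ?case by (rule exI[of _ C]) (simp only: C partial(3) funpow.simps o_apply simp_thms)
qed

text \<open>\<open>A\<close> and \<open>B\<close> are a numerator and a denominator of \<open>Lambda p\<close>, which equals \<open>p\<close>, in the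
  coordinates $\chi^i(x^{(0)})$ and $\kappa_{i,j}$; the first conjunct says that the same \<open>B\<close> is a
  nonzero denominator of \<open>p\<close> in the coordinates $x^{(i)}$ and $\kappa_{i,j}$.\<close>

lemma geometric_invariant_free_form:
  assumes "p \<in> geometric_invariants n"
  shows "\<exists>A B. poly_eval cst (curv_val n xv) B \<noteq> 0 \<and>
    poly_eval cst (curv_val n phiv) A = p * poly_eval cst (curv_val n phiv) B"
proof -
  have pF: "p \<in> F_field n" and Lp: "Lambda p = p"
    using assms by (auto simp: geometric_invariants_def)
  note L = C_hom_UNIV[OF Lambda(1)]
  define R where "R = {r. Lambda r \<in> subst_dom free_val \<and>
    (\<exists>B. poly_eval cst (curv_val n xv) B = r \<and>
      poly_eval cst (curv_val n phiv) B = subst free_val (Lambda r))}"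
  have "\<exists>a\<in>R. \<exists>b\<in>R. b \<noteq> 0 \<and> p = a / b"
  proof (rule C_adjoin_quotient)
    show "p \<in> C_adjoin (indet ` F_vars n)" using pF by (simp add: F_field_def)
    show "cst c \<in> R" for c
      unfolding R_def by (auto simp: L subst_cst intro!: exI[of _ "Poly_Mapping.single 0 c"] cst.poly_eval_const)
    show "a + b \<in> R" if ab: "a \<in> R" "b \<in> R" for a b
    proof -
      obtain A B where "poly_eval cst (curv_val n xv) A = a" "poly_eval cst (curv_val n xv) B = b"
        "poly_eval cst (curv_val n phiv) A = subst free_val (Lambda a)"
        "poly_eval cst (curv_val n phiv) B = subst free_val (Lambda b)"
        using ab unfolding R_def by blast
      then show ?thesis using ab unfolding R_def
        by (auto simp: L subst_arith cst.poly_eval_add intro!: exI[of _ "A + B"])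
    qed
    show "a * b \<in> R" if ab: "a \<in> R" "b \<in> R" for a b
    proof -
      obtain A B where "poly_eval cst (curv_val n xv) A = a" "poly_eval cst (curv_val n xv) B = b"
        "poly_eval cst (curv_val n phiv) A = subst free_val (Lambda a)"
        "poly_eval cst (curv_val n phiv) B = subst free_val (Lambda b)"
        using ab unfolding R_def by blast
      then show ?thesis using ab unfolding R_def
        by (auto simp: L subst_arith cst.poly_eval_mult intro!: exI[of _ "A * B"])
    qed
    show "indet ` F_vars n \<subseteq> R"
    proof clarify
      fix v assume v: "v \<in> F_vars n"
      show "indet v \<in> R"
      proof (cases v)
        case (X i)
        have "poly_eval cst (curv_val n xv) (Poly_Mapping.single (Poly_Mapping.single v (Suc 0)) 1) = indet v"
          unfolding cst.poly_eval_var by (simp add: curv_val_def X)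
        moreover have "poly_eval cst (curv_val n phiv) (Poly_Mapping.single (Poly_Mapping.single v (Suc 0)) 1) =
          (free_chi ^^ i) (xv 0)"
          unfolding cst.poly_eval_var using free_chi_pow_xv by (cases i) (auto simp: curv_val_def X)
        ultimately show ?thesis
          unfolding R_def using subst_free_val_chi_pow[of "var.X 0" n i]
          by (auto simp: X Lambda)
      next
        case (Y j i)
        then have j: "1 \<le> j" "j \<le> n" using v by simp_all
        show ?thesis
          unfolding R_def using subst_free_val_chi_pow[of "var.Y j 0" n i] j curv_val_yv[OF j, of i]
          by (auto simp: Y Lambda)
      next
        case (Phi i)
        then show ?thesis using v by (simp add: F_vars_def)
      qed
    qed
  qed
  then obtain a b where ab: "a \<in> R" "b \<in> R" "b \<noteq> 0" "p = a / b" by blast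
  obtain A B where AB: "poly_eval cst (curv_val n xv) B = b"
    "poly_eval cst (curv_val n phiv) A = subst free_val (Lambda a)"
    "poly_eval cst (curv_val n phiv) B = subst free_val (Lambda b)"
    using ab unfolding R_def by blast
  have d: "Lambda b \<in> subst_dom free_val" using ab unfolding R_def by blast
  \<comment> \<open>Invariance enters through \<open>a = p * b\<close>, and \<open>free_val\<close>
    fixes \<open>p\<close>, which is free of \<phi>. The product form avoids showing that
    \<open>Lambda b\<close> stays nonzero under \<open>free_val\<close>.\<close>
  have "Lambda a = Lambda (p * b)" using ab by simp
  also have "\<dots> = p * Lambda b" by (simp add: L Lp)
  finally have "subst free_val (Lambda a) = p * subst free_val (Lambda b)"
    using subst_fixes_F_field[OF free_val_F_vars pF] d by (simp add: subst_arith)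
  then show ?thesis using AB ab(3) by (intro exI[of _ A] exI[of _ B]) simp
qed

lemma geometric_invariant_in_C_adjoin:
  assumes "p \<in> geometric_invariants n"
  shows "p \<in> C_adjoin ({xv 0} \<union> {yv j 0 | j. 1 \<le> j \<and> j \<le> n} \<union> {kappa i j | i j. 1 \<le> j \<and> j \<le> n})"
    (is "p \<in> C_adjoin ?S")
proof -
  obtain A B where B: "poly_eval cst (curv_val n xv) B \<noteq> 0"
    and AB: "poly_eval cst (curv_val n phiv) A = p * poly_eval cst (curv_val n phiv) B"
    using geometric_invariant_free_form[OF assms] by blast
  \<comment> \<open>Only the \<open>X i\<close> with \<open>i \<noteq> 0\<close> that occur in
    \<open>B\<close> receive constants; \<open>xv 0\<close> and the curvatures keep their
    values.\<close>
  let ?V = "(\<Union>m\<in>Poly_Mapping.keys B. Poly_Mapping.keys m) \<inter> {X i | i. i \<noteq> 0}"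
  have "finite ?V" by simp
  then obtain c where c: "poly_eval cst (\<lambda>v. if v \<in> ?V then cst (c v) else curv_val n xv v) B \<noteq> 0"
    using poly_eval_specialise[OF _ B] by blast
  define \<rho> where "\<rho> = curv_val n (\<lambda>i. cst (c (X i)))"
  \<comment> \<open>The two valuations can differ only at variables absent from
    \<open>B\<close>.\<close>
  have "poly_eval cst (\<lambda>v. if v \<in> ?V then cst (c v) else curv_val n xv v) B = poly_eval cst \<rho> B"
    by (rule poly_eval_cong) (auto simp: \<rho>_def curv_val_def split: var.splits)
  with c have nz: "poly_eval cst \<rho> B \<noteq> 0" by simp
  \<comment> \<open>Sending \<open>phiv i\<close> to the constant chosen for \<open>X i\<close>
    turns \<open>curv_val n phiv\<close> into \<open>\<rho>\<close>, while \<open>p\<close> and the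
    curvatures, being in \<open>F_field n\<close>, stay fixed.\<close>
  define \<sigma> where "\<sigma> v = (case v of Phi i \<Rightarrow> cst (c (X i)) | _ \<Rightarrow> indet v)" for v
  have fix_F: "q \<in> subst_dom \<sigma>" "subst \<sigma> q = q" if "q \<in> F_field n" for q
  proof -
    have "\<sigma> v = indet v" if "v \<in> F_vars n" for v
      using that by (auto simp: \<sigma>_def F_vars_def)
    then show "q \<in> subst_dom \<sigma>" "subst \<sigma> q = q"
      using subst_fixes_F_field that by blast+
  qed
  have fix_0: "0 \<in> subst_dom \<sigma>" "subst \<sigma> 0 = 0"
    using subst_cst[where c = 0 and \<sigma> = \<sigma>] by simp_all
  have cv: "curv_val n phiv v \<in> subst_dom \<sigma> \<and> subst \<sigma> (curv_val n phiv v) = \<rho> v" for v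
    by (cases v) (simp_all add: curv_val_def \<rho>_def fix_F kappa_in_F_field subst_indet fix_0,
      simp_all add: \<sigma>_def)
  then have \<sigma>_\<rho>: "poly_eval cst (curv_val n phiv) a \<in> subst_dom \<sigma>"
    "subst \<sigma> (poly_eval cst (curv_val n phiv) a) = poly_eval cst \<rho> a" for a
    using subst_poly_eval[of "curv_val n phiv" \<sigma> a] by simp_all
  have pF: "p \<in> F_field n" using assms by (simp add: geometric_invariants_def)
  have "poly_eval cst \<rho> A = subst \<sigma> (p * poly_eval cst (curv_val n phiv) B)"
    using \<sigma>_\<rho> AB by metis
  also have "\<dots> = p * poly_eval cst \<rho> B"
    using \<sigma>_\<rho> fix_F[OF pF] by (simp add: subst_arith)
  finally have p: "p = poly_eval cst \<rho> A / poly_eval cst \<rho> B" using nz by simp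
  have S: "?S \<subseteq> C_adjoin ?S" by (rule C_adjoin_superset)
  then have gens: "xv 0 \<in> C_adjoin ?S" "1 \<le> j \<Longrightarrow> j \<le> n \<Longrightarrow> yv j 0 \<in> C_adjoin ?S"
    "1 \<le> j \<Longrightarrow> j \<le> n \<Longrightarrow> kappa i j \<in> C_adjoin ?S" for i j
    by blast+
  have cst_mem: "cst z \<in> C_adjoin ?S" for z by (rule C_adjoin_superset)
  have zero: "0 \<in> C_adjoin ?S" by (rule is_subfield_closed(1)[OF C_adjoin_subfield])
  have \<rho>_mem: "\<rho> v \<in> C_adjoin ?S" for v
  proof (cases v)
    case (X i)
    then show ?thesis using gens(1) cst_mem by (simp add: \<rho>_def curv_val_def)
  next
    case (Y j i)
    then show ?thesis using gens(2,3)[of j] zero by (simp add: \<rho>_def curv_val_def)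
  next
    case (Phi i)
    then show ?thesis using zero by (simp add: \<rho>_def curv_val_def)
  qed
  have mem: "poly_eval cst \<rho> a \<in> C_adjoin ?S" for a
    by (rule poly_eval_in_subfield[OF C_adjoin_subfield]) (use cst_mem \<rho>_mem in blast)+
  show ?thesis unfolding p by (rule is_subfield_closed(8)[OF C_adjoin_subfield mem mem])
qed

theorem theorem3p2:
  fixes n :: nat
  assumes "n \<ge> 1"
  shows "geometric_invariants n =
           C_adjoin ({xv 0} \<union> {yv j 0 | j. 1 \<le> j \<and> j \<le> n} \<union> {kappa i j | i j. 1 \<le> j \<and> j \<le> n})
         \<and> (\<forall>p \<in> geometric_invariants n. p \<in> i_kappa_dom \<and> p = i_kappa p)"
proof -
  let ?S = "{xv 0} \<union> {yv j 0 | j. 1 \<le> j \<and> j \<le> n} \<union> {kappa i j | i j. 1 \<le> j \<and> j \<le> n}"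
  have "C_adjoin ?S \<subseteq> geometric_invariants n"
  proof (rule C_adjoin_minimal[OF geometric_invariants_subfield])
    show "range cst \<subseteq> geometric_invariants n"
      by (auto simp: geometric_invariants_def cst_in_F_field C_hom_UNIV[OF Lambda(1)])
    \<comment> \<open>At order zero \<open>Lambda\<close> applies \<open>chi\<close> zero times, so
      these variables are fixed.\<close>
    have "yv j 0 \<in> geometric_invariants n" if "1 \<le> j" "j \<le> n" for j
      using that by (simp_all add: geometric_invariants_def Lambda indet_in_F_field)
    moreover have "xv 0 \<in> geometric_invariants n"
      by (simp add: geometric_invariants_def Lambda indet_in_F_field)
    ultimately show "?S \<subseteq> geometric_invariants n"
      by (auto simp del: kappa.simps intro: kappa_geometric_invariant)
  qed
  then have eq: "geometric_invariants n = C_adjoin ?S"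
    by (rule equalityI[rotated]) (intro subsetI geometric_invariant_in_C_adjoin)
  have fixed: "s \<in> subst_dom i_kappa_val \<and> subst i_kappa_val s = s" if "s \<in> ?S" for s
  proof -
    from that consider "s = xv 0" | j where "s = yv j 0" | i j where "s = kappa i j" by blast
    then show ?thesis
    proof cases
      case 3
      then show ?thesis using i_kappa_kappa[of i j] by (simp add: i_kappa_dom_def i_kappa_def)
    qed (simp_all add: subst_indet)
  qed
  have i: "p \<in> i_kappa_dom \<and> p = i_kappa p" if "p \<in> geometric_invariants n" for p
  proof -
    have p: "p \<in> C_adjoin ?S" using that unfolding eq .
    \<comment> \<open>The elements of the domain fixed by the substitution form a field, so both
      properties pass from the generators to every invariant.\<close>
    have "p \<in> subst_dom i_kappa_val" "subst i_kappa_val p = p"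
      by (rule subst_fixes_C_adjoin[OF _ p], erule fixed)+
    then show ?thesis by (simp add: i_kappa_dom_def i_kappa_def)
  qed
  show ?thesis by (intro conjI[OF eq] ballI i)
qed

end
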